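(* Let $d,n\in\mathbb{N}$ with $n>d$, and let $X_1,\dots,X_n$ be independent random variables, each uniformly distributed on $[0,1]^d$. Then $$\max\left\{\frac{\log(n)}{9\,n},\ \frac{d}{2\mathrm{e}\,n}\right\}\ \leq\ \mathbb{E}\bigl(\operatorname{disp}(X_1,\dots,X_n)\bigr)\ \leq\ \frac{9d}{n}\,\log\left(\frac{\mathrm{e}\,n}{d}\right).$$
   Context: $\mathbb{N}=\{1,2,\dots\}$, $\log$ is the natural logarithm and $\mathrm{e}$ is Euler's number. For points $x_1,\dots,x_n\in[0,1]^d$ the dispersion is $$\operatorname{disp}(x_1,\dots,x_n):=\sup_{B\cap\{x_1,\dots,x_n\}=\emptyset}\lambda_d(B),$$ where $\lambda_d$ is the $d$-dimensional Lebesgue measure and the supremum is over all axis-parallel boxes $B=I_1\times\dots\times I_d$ with intervals $I_k\subseteq[0,1]$ that contain none of the points. (The supremum is unchanged if one restricts to half-open boxes $\prod_{k=1}^d[a^{(k)},b^{(k)})\subseteq[0,1]^d$ with rational endpoints $a^{(k)},b^{(k)}\in\mathbb{Q}\cap[0,1]$; hence $\operatorname{disp}$ is a measurable function of the points.) All random variables are defined on a common probability space $(\Omega,\mathcal{F},\mathbb{P})$ and $\mathbb{E}$ denotes expectation. *)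

theory Defs
  imports "HOL-Probability.Probability"
begin

definition unit_cube :: "(real ^ 'd) set" where
  "unit_cube = {x. \<forall>k. x $ k \<in> {0..1}}"

text \<open>The intervals \<open>I k\<close> may be open, closed, half-open, degenerate or empty.\<close>

definition axis_parallel_box :: "(real ^ 'd) set \<Rightarrow> bool" where
  "axis_parallel_box B \<longleftrightarrow>
     (\<exists>I :: 'd \<Rightarrow> real set. (\<forall>k. is_interval (I k) \<and> I k \<subseteq> {0..1}) \<and>
        B = {x. \<forall>k. x $ k \<in> I k})"

text \<open>The points are \<open>x 1, \<dots>, x n\<close>. The real-valued supremum ranges over a nonempty set
  (the empty box is admissible) of numbers in \<open>{0..1}\<close>.\<close>

definition disp :: "nat \<Rightarrow> (nat \<Rightarrow> real ^ 'd) \<Rightarrow> real" where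
  "disp n x = (SUP B \<in> {B. axis_parallel_box B \<and> B \<inter> x ` {1..n} = {}}. measure lborel B)"

end

theory Submission
  imports Defs
begin

text \<open>
  Write \<open>d\<close> for the dimension and \<open>|B|\<close> for the volume of a box \<open>B\<close>.
  Three independent arguments give the three bounds.

  \<^emph>\<open>Upper bound.\<close> Instead of covering the boxes by a finite family, integrate over all boxes at once.
  Let \<open>J\<close> be the integral of \<open>|[a, b]|^p\<close> over all pairs of corners \<open>a < b\<close> in the cube for which
  \<open>[a, b]\<close> contains no sample point. If a box \<open>B\<close> is empty, so are all its sub-boxes, and these
  alone contribute \<open>|B|^(p+2) / ((p+1)(p+2))^d\<close>, because the integral factorizes over the
  coordinates. Hence \<open>disp^(p+2) \<le> ((p+1)(p+2))^d J\<close> (\<open>disp_power_le\<close>). On the other hand a fixed box of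
  volume \<open>V\<close> is empty with probability \<open>(1-V)^n\<close>, so the mean of \<open>J\<close> is the integral of
  \<open>V^p (1-V)^n\<close>; trading \<open>V^s (1-V)^n \<le> (s/(e n))^s\<close> for \<open>s\<close> of the \<open>p\<close> powers leaves the same kind of
  integral with exponent \<open>q = p - s\<close> (\<open>expectation_disp_power_le\<close>). With \<open>q = d - 1\<close> and \<open>s = d t\<close>
  all dimension-dependent factors become \<open>d\<close>-th powers, and \<open>t\<close> about \<open>2 ln(e n/d)\<close> gives
  \<open>4 (d/n) ln(e n/d)\<close> (\<open>expectation_disp_upper\<close>).

  \<^emph>\<open>Lower bound linear in \<open>d\<close>.\<close> The slab \<open>{x. x\<^sub>0 < d/n}\<close> has volume \<open>d/n\<close> and contains about
  \<open>d\<close> points. Each of them can be removed by raising the lower face of the slab in the coordinate in which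
  the point lies lowest; this costs a factor \<open>1 - min\<^sub>k x\<^sub>k\<close>, and the minimum of \<open>d - 1\<close> uniform
  coordinates has mean \<open>1/d\<close>. So the loss per sample point is \<open>1/n\<close> on average, and independence turns the product
  of the losses into \<open>(1 - 1/n)^n\<close> (\<open>expectation_disp_ge_dim\<close>).

  \<^emph>\<open>Logarithmic lower bound.\<close> Cut the cube into \<open>m\<close> parallel slabs. As in the coupon
  collector problem, for \<open>m\<close> of order \<open>n / ln n\<close> some slab stays empty with probability at least \<open>1/2\<close>,
  which follows from the first two moments of the number of empty slabs (\<open>expectation_disp_ge_slabs\<close>).

  As the expectation is a Bochner integral, it carries information only once the dispersion is known to be
  measurable; this is \<open>borel_measurable_disp\<close>.
\<close>

section \<open>Integrals and volumes in coordinates\<close>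

lemma prod_Basis_vec:
  fixes g :: "real ^ 'd \<Rightarrow> 'b::comm_monoid_mult"
  shows "(\<Prod>b\<in>Basis. g b) = (\<Prod>k\<in>UNIV. g (axis k 1))"
proof -
  have "(Basis :: (real ^ 'd) set) = (\<lambda>k. axis k 1) ` UNIV"
    by (auto simp: Basis_vec_def)
  moreover have "inj (\<lambda>k::'d. axis k (1::real))"
    by (auto simp: inj_def axis_eq_axis)
  ultimately show ?thesis
    using prod.reindex[of "\<lambda>k::'d. axis k (1::real)" UNIV g] by (simp add: o_def)
qed

lemma nn_integral_lborel_vec_prod:
  fixes f :: "'d::finite \<Rightarrow> real \<Rightarrow> ennreal"
  assumes [measurable]: "\<And>k. f k \<in> borel_measurable borel"
  shows "(\<integral>\<^sup>+(x::real^'d). (\<Prod>k\<in>UNIV. f k (x $ k)) \<partial>lborel) = (\<Prod>k\<in>UNIV. \<integral>\<^sup>+t. f k t \<partial>lborel)"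
proof -
  have "(\<integral>\<^sup>+(x::real^'d). (\<Prod>b\<in>Basis. f (axis_index b) (x \<bullet> b)) \<partial>lborel)
        = (\<Prod>b\<in>(Basis::(real^'d) set). \<integral>\<^sup>+t. f (axis_index b) t \<partial>lborel)"
    by (rule nn_integral_lborel_prod) auto
  then show ?thesis
    by (simp add: prod_Basis_vec axis_index_axis inner_axis)
qed

lemma measure_box_vec:
  fixes a b :: "real ^ 'd"
  assumes "\<And>k. a $ k \<le> b $ k"
  shows "measure lborel (box a b) = (\<Prod>k\<in>UNIV. b $ k - a $ k)"
    and "measure lborel (cbox a b) = (\<Prod>k\<in>UNIV. b $ k - a $ k)"
proof -
  have *: "\<forall>i\<in>Basis. a \<bullet> i \<le> b \<bullet> i"
    using assms by (auto simp: Basis_vec_def inner_axis)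
  show "measure lborel (box a b) = (\<Prod>k\<in>UNIV. b $ k - a $ k)"
    using * by (simp add: measure_lborel_box_eq prod_Basis_vec inner_axis)
  show "measure lborel (cbox a b) = (\<Prod>k\<in>UNIV. b $ k - a $ k)"
    using * by (simp add: measure_lborel_cbox_eq prod_Basis_vec inner_axis)
qed

section \<open>Dispersion as a supremum over open boxes\<close>

definition cube_corners :: "real ^ 'd \<Rightarrow> real ^ 'd \<Rightarrow> bool" where
  "cube_corners a b \<longleftrightarrow> (\<forall>k. 0 \<le> a $ k \<and> a $ k \<le> b $ k \<and> b $ k \<le> 1)"

lemma cube_cornersD:
  assumes "cube_corners a b"
  shows "0 \<le> a $ k" "a $ k \<le> b $ k" "b $ k \<le> 1" "0 \<le> b $ k - a $ k" "b $ k - a $ k \<le> 1"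
proof -
  have *: "0 \<le> a $ k \<and> a $ k \<le> b $ k \<and> b $ k \<le> 1"
    using assms unfolding cube_corners_def by blast
  then show "0 \<le> a $ k" "a $ k \<le> b $ k" "b $ k \<le> 1" "0 \<le> b $ k - a $ k" "b $ k - a $ k \<le> 1"
    by auto
qed

text \<open>
  The infima and suprema of the side intervals are the corners. The inclusion in the closed box bounds
  the measure of \<open>B\<close> from above, so open boxes suffice in the supremum that defines
  the dispersion.
\<close>

lemma axis_parallel_box_core:
  fixes B :: "(real ^ 'd) set"
  assumes "axis_parallel_box B"
  obtains a b where "cube_corners a b" "box a b \<subseteq> B" "measure lborel B \<le> (\<Prod>k\<in>UNIV. b $ k - a $ k)"
proof -
  obtain I :: "'d \<Rightarrow> real set" where *: "\<forall>k. is_interval (I k) \<and> I k \<subseteq> {0..1}"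
    and B: "B = {x. \<forall>k. x $ k \<in> I k}"
    using assms unfolding axis_parallel_box_def by (elim exE conjE)
  from * have I: "is_interval (I k)" "I k \<subseteq> {0..1}" for k by simp_all
  show thesis
  proof (cases "B = {}")
    case True
    have "box 0 (0::real^'d) = {}" by (auto simp: mem_box_cart)
    then show ?thesis
      using that[of 0 0] True by (simp add: cube_corners_def prod_nonneg)
  next
    case False
    then obtain x where x: "\<And>k. x $ k \<in> I k" using B by auto
    have bdd: "bdd_below (I k)" "bdd_above (I k)" for k
      using bdd_below_mono[OF bdd_below_Icc I(2)] bdd_above_mono[OF bdd_above_Icc I(2)] by auto
    define a :: "real^'d" where "a = (\<chi> k. Inf (I k))"
    define b :: "real^'d" where "b = (\<chi> k. Sup (I k))"
    have ak: "0 \<le> a $ k" for k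
      unfolding a_def vec_lambda_beta using x[of k] I(2)[of k] by (intro cInf_greatest) auto
    have bk: "b $ k \<le> 1" for k
      unfolding b_def vec_lambda_beta using x[of k] I(2)[of k] by (intro cSup_least) auto
    have Ik: "a $ k \<le> t" "t \<le> b $ k" if "t \<in> I k" for k t
      unfolding a_def b_def vec_lambda_beta using bdd that by (auto intro: cInf_lower cSup_upper)
    have ab: "a $ k \<le> b $ k" for k using Ik[OF x[of k]] by linarith
    have inI: "t \<in> I k" if t: "a $ k < t" "t < b $ k" for t k
    proof -
      have ne: "I k \<noteq> {}" using x[of k] by auto
      obtain u where "u \<in> I k" "u < t"
        using t(1) cInf_lessD[OF ne] unfolding a_def vec_lambda_beta by blast
      moreover obtain v where "v \<in> I k" "t < v"
        using t(2) less_cSupD[OF ne] unfolding b_def vec_lambda_beta by blast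
      ultimately show ?thesis
        using I(1)[of k] unfolding is_interval_1 by (metis less_imp_le)
    qed
    have "box a b \<subseteq> B"
      unfolding B using inI by (auto simp: mem_box_cart)
    moreover have "measure lborel B \<le> measure lborel (cbox a b)"
    proof (cases "B \<in> sets lborel")
      case True
      have "B \<subseteq> cbox a b" unfolding B using Ik by (auto simp: mem_box_cart)
      then show ?thesis using True
        by (intro measure_mono_fmeasurable) auto
    qed (simp add: measure_notin_sets)
    ultimately show ?thesis
      using that[of a b] ak bk ab by (simp add: cube_corners_def measure_box_vec)
  qed
qed

lemma axis_parallel_box_le_1:
  assumes "axis_parallel_box B"
  shows "measure lborel B \<le> 1"
proof -
  obtain a b where ab: "cube_corners a b" "box a b \<subseteq> B"
    "measure lborel B \<le> (\<Prod>k\<in>UNIV. b $ k - a $ k)"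
    by (rule axis_parallel_box_core[OF assms])
  have "(\<Prod>k\<in>UNIV. b $ k - a $ k) \<le> 1"
    using cube_cornersD(4,5)[OF ab(1)] by (intro prod_le_1) simp
  with ab(3) show ?thesis by linarith
qed

lemma axis_parallel_box_box:
  assumes "cube_corners a b"
  shows "axis_parallel_box (box a b)"
proof -
  have "{a $ k <..< b $ k} \<subseteq> {0..1}" for k
    using cube_cornersD(1)[OF assms, of k] cube_cornersD(3)[OF assms, of k] by auto
  moreover have "is_interval {a $ k <..< b $ k}" for k
    by simp
  ultimately show ?thesis
    unfolding axis_parallel_box_def
    by (intro exI[of _ "\<lambda>k. {a $ k <..< b $ k}"]) (auto simp: mem_box_cart)
qed

lemma disp_bdd_above:
  "bdd_above (measure lborel ` {B. axis_parallel_box B \<and> B \<inter> x ` {1..n} = {}})"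
  by (rule bdd_aboveI2[of _ _ 1]) (auto simp: axis_parallel_box_le_1)

lemma disp_ge_box:
  assumes "cube_corners a b" "box a b \<inter> x ` {1..n} = {}"
  shows "(\<Prod>k\<in>UNIV. b $ k - a $ k) \<le> disp n x"
proof -
  have "measure lborel (box a b) \<le> disp n x"
    unfolding disp_def using assms axis_parallel_box_box
    by (intro cSUP_upper disp_bdd_above) auto
  then show ?thesis
    using measure_box_vec(1)[of a b] cube_cornersD(2)[OF assms(1)] by simp
qed

lemma disp_le_boxes:
  fixes x :: "nat \<Rightarrow> real ^ 'd"
  assumes "\<And>a b. cube_corners a b \<Longrightarrow> box a b \<inter> x ` {1..n} = {} \<Longrightarrow> (\<Prod>k\<in>UNIV. b $ k - a $ k) \<le> c"
  shows "disp n x \<le> c"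
  unfolding disp_def
proof (rule cSUP_least)
  have "axis_parallel_box (box 0 (0::real^'d))"
    by (rule axis_parallel_box_box) (simp add: cube_corners_def)
  moreover have "box 0 (0::real^'d) = {}"
    by (auto simp: box_eq_empty mem_box_cart)
  ultimately show "{B. axis_parallel_box B \<and> B \<inter> x ` {1..n} = {}} \<noteq> {}"
    by (metis (mono_tags, lifting) Int_empty_left empty_iff mem_Collect_eq)
next
  fix B assume B: "B \<in> {B. axis_parallel_box B \<and> B \<inter> x ` {1..n} = {}}"
  then have "axis_parallel_box B" by simp
  then obtain a b where ab: "cube_corners a b" "box a b \<subseteq> B"
    "measure lborel B \<le> (\<Prod>k\<in>UNIV. b $ k - a $ k)"
    by (rule axis_parallel_box_core)
  from ab(2) B have "box a b \<inter> x ` {1..n} = {}" by blast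
  from assms[OF ab(1) this] ab(3) show "measure lborel B \<le> c" by linarith
qed

lemma disp_le_1: "disp n x \<le> 1"
  by (rule disp_le_boxes) (auto intro!: prod_le_1 simp: cube_cornersD)

lemma disp_nonneg: "0 \<le> disp n (x :: nat \<Rightarrow> real ^ 'd)"
proof -
  have "(\<Prod>k\<in>UNIV. (0::real^'d) $ k - (0::real^'d) $ k) \<le> disp n x"
    by (rule disp_ge_box) (auto simp: cube_corners_def mem_box_cart)
  then show ?thesis by (simp add: power_0_left)
qed

section \<open>Measurability of the dispersion\<close>

lemma open_Collect_all_finite:
  fixes P :: "'d::finite \<Rightarrow> 'a::topological_space \<Rightarrow> bool"
  assumes "\<And>k. open {z. P k z}"
  shows "open {z. \<forall>k. P k z}"
proof -
  have "{z. \<forall>k. P k z} = (\<Inter>k. {z. P k z})" by auto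
  then show ?thesis using assms by auto
qed

text \<open>
  If an open box is empty and has volume above \<open>c\<close>, then slightly smaller closed boxes inside it still
  have volume above \<open>c\<close>. Their corner pairs form an open set, which must meet a countable dense set of
  pairs; hence countably many boxes decide whether the dispersion exceeds \<open>c\<close>. Sample points on the faces of the
  open box do no harm, since the closed boxes stay away from these faces.
\<close>

lemma countable_dense_boxes:
  obtains D :: "((real ^ 'd) \<times> (real ^ 'd)) set" where "countable D"
    "\<And>n x c. 0 \<le> c \<Longrightarrow> c < disp n x \<longleftrightarrow>
       (\<exists>(a, b)\<in>D. cube_corners a b \<and> c < (\<Prod>k\<in>UNIV. b $ k - a $ k) \<and> (\<forall>i\<in>{1..n}. x i \<notin> cbox a b))"
proof -
  obtain D :: "((real ^ 'd) \<times> (real ^ 'd)) set" where D: "countable D"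
    "\<And>U. open U \<Longrightarrow> U \<noteq> {} \<Longrightarrow> \<exists>d\<in>D. d \<in> U"
    by (erule countable_dense_setE)
  show thesis
  proof (rule that[OF D(1)])
    fix n and x :: "nat \<Rightarrow> real ^ 'd" and c :: real
    assume c: "0 \<le> c"
    let ?R = "\<exists>(a, b)\<in>D. cube_corners a b \<and> c < (\<Prod>k\<in>UNIV. b $ k - a $ k) \<and> (\<forall>i\<in>{1..n}. x i \<notin> cbox a b)"
    show "c < disp n x \<longleftrightarrow> ?R"
    proof
      assume ?R
      then obtain a b where ab: "cube_corners a b" "c < (\<Prod>k\<in>UNIV. b $ k - a $ k)"
        "\<forall>i\<in>{1..n}. x i \<notin> cbox a b" by auto
      have "box a b \<inter> x ` {1..n} = {}"
        using ab(3) box_subset_cbox[of a b] by auto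
      with ab show "c < disp n x" using disp_ge_box[of a b x n] by linarith
    next
      assume "c < disp n x"
      then obtain \<alpha> \<beta> where ab: "cube_corners \<alpha> \<beta>" "box \<alpha> \<beta> \<inter> x ` {1..n} = {}"
        and cab: "c < (\<Prod>k\<in>UNIV. \<beta> $ k - \<alpha> $ k)"
        using disp_le_boxes[of x n c] by (meson linorder_not_le)
      have lt: "\<alpha> $ k < \<beta> $ k" for k
      proof (rule ccontr)
        assume "\<not> \<alpha> $ k < \<beta> $ k"
        then have "\<beta> $ k - \<alpha> $ k = 0" using cube_cornersD(2)[OF ab(1), of k] by simp
        then have "(\<Prod>k\<in>UNIV. \<beta> $ k - \<alpha> $ k) = 0" by (intro prod_zero) auto
        then show False using c cab by linarith
      qed
      define U where "U = {z :: (real^'d) \<times> (real^'d). c < (\<Prod>k\<in>UNIV. snd z $ k - fst z $ k)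
           \<and> (\<forall>k. \<alpha> $ k < fst z $ k \<and> fst z $ k < snd z $ k \<and> snd z $ k < \<beta> $ k)}"
      have "open U"
        unfolding U_def
        by (intro open_Collect_conj open_Collect_all_finite open_Collect_less continuous_intros)
      \<comment> \<open>Shrinking the box towards its centre by a factor \<open>1 - 2 \<eta>\<close> shows that \<open>U\<close> is nonempty.\<close>
      have "((\<lambda>\<eta>. \<Prod>k\<in>UNIV. (1 - 2 * \<eta>) * (\<beta> $ k - \<alpha> $ k)) \<longlongrightarrow> (\<Prod>k\<in>UNIV. (1 - 2 * 0) * (\<beta> $ k - \<alpha> $ k))) (at_right (0::real))"
        by (intro tendsto_intros)
      then have "\<forall>\<^sub>F \<eta> in at_right (0::real). c < (\<Prod>k\<in>UNIV. (1 - 2 * \<eta>) * (\<beta> $ k - \<alpha> $ k))"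
        using cab by (intro order_tendstoD(1)) auto
      moreover have "\<forall>\<^sub>F \<eta> in at_right (0::real). \<eta> \<in> {0<..<1/2}"
        by (rule eventually_at_right_real) simp
      ultimately have "\<forall>\<^sub>F \<eta> in at_right (0::real). c < (\<Prod>k\<in>UNIV. (1 - 2 * \<eta>) * (\<beta> $ k - \<alpha> $ k)) \<and> \<eta> \<in> {0<..<1/2}"
        by eventually_elim simp
      then have "\<exists>\<eta>. c < (\<Prod>k\<in>UNIV. (1 - 2 * \<eta>) * (\<beta> $ k - \<alpha> $ k)) \<and> \<eta> \<in> {0<..<1/2 :: real}"
        by (rule eventually_happens'[rotated]) simp
      then obtain \<eta> :: real where \<eta>: "c < (\<Prod>k\<in>UNIV. (1 - 2 * \<eta>) * (\<beta> $ k - \<alpha> $ k))" "0 < \<eta>" "\<eta> < 1/2"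
        by (elim exE conjE) (simp only: greaterThanLessThan_iff)
      have "(\<alpha> + \<eta> *\<^sub>R (\<beta> - \<alpha>), \<beta> - \<eta> *\<^sub>R (\<beta> - \<alpha>)) \<in> U"
      proof -
        define e where "e k = \<eta> * (\<beta> $ k - \<alpha> $ k)" for k
        have e: "\<beta> $ k - e k - (\<alpha> $ k + e k) = (1 - 2 * \<eta>) * (\<beta> $ k - \<alpha> $ k)" for k
          unfolding e_def by (simp only: left_diff_distrib) simp
        have pos: "0 < e k" "0 < \<beta> $ k - e k - (\<alpha> $ k + e k)" for k
          unfolding e using \<eta>(2,3) lt[of k] unfolding e_def by (intro mult_pos_pos; simp)+
        have "\<alpha> $ k < \<alpha> $ k + e k \<and> \<alpha> $ k + e k < \<beta> $ k - e k \<and> \<beta> $ k - e k < \<beta> $ k" for k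
          using pos[of k] by linarith
        moreover have "c < (\<Prod>k\<in>UNIV. \<beta> $ k - e k - (\<alpha> $ k + e k))"
          unfolding e by (rule \<eta>(1))
        ultimately show ?thesis
          unfolding U_def e_def by simp
      qed
      then obtain a b where z: "(a, b) \<in> D" "(a, b) \<in> U"
        using D(2)[OF \<open>open U\<close>] by force
      have U: "\<alpha> $ k < a $ k" "a $ k < b $ k" "b $ k < \<beta> $ k" for k
        using z(2) by (auto simp: U_def)
      have "cube_corners a b"
      proof (unfold cube_corners_def, intro allI conjI)
        fix k show "0 \<le> a $ k" "a $ k \<le> b $ k" "b $ k \<le> 1"
          using U[of k] cube_cornersD(1,3)[OF ab(1), of k] by linarith+
      qed
      moreover have "c < (\<Prod>k\<in>UNIV. b $ k - a $ k)" using z(2) by (simp add: U_def)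
      moreover have "cbox a b \<subseteq> box \<alpha> \<beta>"
        using less_le_trans[OF U(1)] le_less_trans[OF _ U(3)] by (auto simp: mem_box_cart)
      ultimately show ?R using z(1) ab(2) by auto
    qed
  qed
qed

lemma borel_measurable_disp:
  fixes X :: "nat \<Rightarrow> 'a \<Rightarrow> real ^ 'd"
  assumes "\<And>i. i \<in> {1..n} \<Longrightarrow> X i \<in> borel_measurable M"
  shows "(\<lambda>\<omega>. disp n (\<lambda>i. X i \<omega>)) \<in> borel_measurable M"
proof (rule borel_measurable_iff_greater[THEN iffD2], rule allI)
  fix c :: real
  obtain D :: "((real ^ 'd) \<times> (real ^ 'd)) set" where D: "countable D"
    "\<And>n x c. 0 \<le> c \<Longrightarrow> c < disp n x \<longleftrightarrow>
       (\<exists>(a, b)\<in>D. cube_corners a b \<and> c < (\<Prod>k\<in>UNIV. b $ k - a $ k) \<and> (\<forall>i\<in>{1..n}. x i \<notin> cbox a b))"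
    using countable_dense_boxes by blast
  show "{\<omega> \<in> space M. c < disp n (\<lambda>i. X i \<omega>)} \<in> sets M"
  proof (cases "0 \<le> c")
    case True
    have "{\<omega> \<in> space M. c < disp n (\<lambda>i. X i \<omega>)}
      = (\<Union>z\<in>{(a,b). (a, b) \<in> D \<and> cube_corners a b \<and> c < (\<Prod>k\<in>UNIV. b $ k - a $ k)}.
           {\<omega> \<in> space M. \<forall>i\<in>{1..n}. X i \<omega> \<notin> cbox (fst z) (snd z)})"
      unfolding D(2)[OF True] by auto
    also have "\<dots> \<in> sets M"
    proof (rule sets.countable_UN'')
      show "countable {(a,b). (a, b) \<in> D \<and> cube_corners a b \<and> c < (\<Prod>k\<in>UNIV. b $ k - a $ k)}"
        by (rule countable_subset[OF _ D(1)]) auto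
    next
      fix z :: "(real^'d) \<times> (real^'d)"
      have "{\<omega> \<in> space M. \<forall>i\<in>{1..n}. X i \<omega> \<in> - cbox (fst z) (snd z)} \<in> sets M"
        by (intro sets.sets_Collect_finite_All measurable_sets_Collect[OF assms]) auto
      then show "{\<omega> \<in> space M. \<forall>i\<in>{1..n}. X i \<omega> \<notin> cbox (fst z) (snd z)} \<in> sets M"
        by simp
    qed
    finally show ?thesis .
  next
    case False
    have "c < disp n (\<lambda>i. X i \<omega>)" for \<omega>
      using disp_nonneg[of n "\<lambda>i. X i \<omega>"] False by linarith
    then have "{\<omega> \<in> space M. c < disp n (\<lambda>i. X i \<omega>)} = space M"
      by auto
    then show ?thesis by simp
  qed
qed

section \<open>Independent uniform points\<close>

lemma unit_cube_eq_cbox: "(unit_cube :: (real ^ 'd) set) = cbox 0 1"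
  by (auto simp: unit_cube_def mem_box_cart)

lemma emeasure_unit_cube: "emeasure lborel (unit_cube :: (real ^ 'd) set) = 1"
  unfolding unit_cube_eq_cbox
  by (subst emeasure_lborel_cbox) (simp_all add: prod_Basis_vec inner_axis, auto simp: Basis_vec_def inner_axis)

lemma unit_cube_sets [measurable]: "unit_cube \<in> sets borel"
  unfolding unit_cube_eq_cbox by simp

lemma prob_space_unit_cube: "prob_space (uniform_measure lborel (unit_cube :: (real ^ 'd) set))"
  by (rule prob_space_uniform_measure) (auto simp: emeasure_unit_cube)

lemma measure_unit_cube_box:
  fixes a b :: "real ^ 'd"
  assumes "cube_corners a b"
  shows "measure (uniform_measure lborel unit_cube) (cbox a b) = (\<Prod>k\<in>UNIV. b $ k - a $ k)"
    and "measure (uniform_measure lborel unit_cube) (box a b) = (\<Prod>k\<in>UNIV. b $ k - a $ k)"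
proof -
  have sub: "cbox a b \<subseteq> unit_cube"
    unfolding unit_cube_def using cube_cornersD(1,3)[OF assms]
    by (fastforce simp: mem_box_cart intro: order_trans)
  have le: "\<And>k. a $ k \<le> b $ k" using cube_cornersD(2)[OF assms] .
  have m1: "measure lborel (unit_cube :: (real ^ 'd) set) = 1"
    by (simp add: measure_def emeasure_unit_cube)
  show "measure (uniform_measure lborel unit_cube) (cbox a b) = (\<Prod>k\<in>UNIV. b $ k - a $ k)"
    using sub by (simp add: m1 emeasure_unit_cube measure_box_vec[OF le] Int_absorb1)
  have "box a b \<subseteq> unit_cube" using sub box_subset_cbox[of a b] by blast
  then show "measure (uniform_measure lborel unit_cube) (box a b) = (\<Prod>k\<in>UNIV. b $ k - a $ k)"
    by (simp add: m1 emeasure_unit_cube measure_box_vec[OF le] Int_absorb1)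
qed

locale uniform_sample = prob_space M for M :: "'a measure" +
  fixes X :: "nat \<Rightarrow> 'a \<Rightarrow> real ^ 'd" and n :: nat
  assumes indep: "indep_vars (\<lambda>_. borel) X {1..n}"
    and unif: "\<And>i. i \<in> {1..n} \<Longrightarrow> distr M borel (X i) = uniform_measure lborel unit_cube"
begin

abbreviation "\<U> \<equiv> uniform_measure lborel (unit_cube :: (real ^ 'd) set)"

lemma measurable_X [measurable]: "i \<in> {1..n} \<Longrightarrow> X i \<in> borel_measurable M"
  using indep unfolding indep_vars_def by auto

text \<open>
  Every probability below is the expectation of a product of one function over the
  independent sample points, so that it is an \<open>n\<close>-th power.
\<close>

lemma expectation_prod:
  fixes f :: "real ^ 'd \<Rightarrow> real"
  assumes [measurable]: "f \<in> borel_measurable borel" and bdd: "\<And>x. \<bar>f x\<bar> \<le> C"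
  shows "expectation (\<lambda>\<omega>. \<Prod>i\<in>{1..n}. f (X i \<omega>)) = (\<integral>x. f x \<partial>\<U>) ^ n"
    and "integrable M (\<lambda>\<omega>. \<Prod>i\<in>{1..n}. f (X i \<omega>))"
proof -
  have ind: "indep_vars (\<lambda>_. borel) (\<lambda>i \<omega>. f (X i \<omega>)) {1..n}"
    by (rule indep_vars_compose2[OF indep]) auto
  have int: "integrable M (\<lambda>\<omega>. f (X i \<omega>))" if "i \<in> {1..n}" for i
    by (rule integrable_const_bound[where B = C, OF _ measurable_compose[OF measurable_X[OF that] assms(1)]])
       (simp add: bdd)
  have "expectation (\<lambda>\<omega>. f (X i \<omega>)) = (\<integral>x. f x \<partial>\<U>)" if "i \<in> {1..n}" for i
    using integral_distr[OF measurable_X[OF that], of f] unif[OF that] by simp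
  then show "expectation (\<lambda>\<omega>. \<Prod>i\<in>{1..n}. f (X i \<omega>)) = (\<integral>x. f x \<partial>\<U>) ^ n"
    using indep_vars_lebesgue_integral[OF finite_atLeastAtMost ind int] by simp
  show "integrable M (\<lambda>\<omega>. \<Prod>i\<in>{1..n}. f (X i \<omega>))"
    using indep_vars_integrable[OF finite_atLeastAtMost ind int] .
qed

lemma expectation_avoid:
  assumes A[measurable]: "A \<in> sets borel"
  shows "expectation (\<lambda>\<omega>. \<Prod>i\<in>{1..n}. indicator (- A) (X i \<omega>)) = (1 - measure \<U> A) ^ n"
    and "integrable M (\<lambda>\<omega>. \<Prod>i\<in>{1..n}. indicator (- A) (X i \<omega>) :: real)"
proof -
  interpret U: prob_space \<U> by (rule prob_space_unit_cube)
  have cA: "- A \<in> sets borel" using A by auto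
  have "(\<integral>x. indicator (- A) x \<partial>\<U>) = measure \<U> (- A)"
    by simp
  also have "\<dots> = 1 - measure \<U> A"
    using U.prob_compl[of A] A by (simp add: Compl_eq_Diff_UNIV)
  finally have *: "(\<integral>x. indicator (- A) x \<partial>\<U>) = 1 - measure \<U> A" .
  show "expectation (\<lambda>\<omega>. \<Prod>i\<in>{1..n}. indicator (- A) (X i \<omega>)) = (1 - measure \<U> A) ^ n"
    using cA by (subst expectation_prod(1)[where C = 1]) (auto simp: * split: split_indicator simp del: Bochner_Integration.integral_indicator)
  show "integrable M (\<lambda>\<omega>. \<Prod>i\<in>{1..n}. indicator (- A) (X i \<omega>) :: real)"
    using cA by (intro expectation_prod(2)[where C = 1]) (auto simp: indicator_def)
qed

lemma measurable_disp [measurable]: "(\<lambda>\<omega>. disp n (\<lambda>i. X i \<omega>)) \<in> borel_measurable M"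
  by (rule borel_measurable_disp) (rule measurable_X)

lemma integrable_disp: "integrable M (\<lambda>\<omega>. disp n (\<lambda>i. X i \<omega>))"
  by (rule integrable_const_bound[where B = 1, OF _ measurable_disp]) (simp add: disp_nonneg disp_le_1)

lemma integrable_disp_power: "integrable M (\<lambda>\<omega>. disp n (\<lambda>i. X i \<omega>) ^ N)"
  by (rule integrable_const_bound[where B = 1, OF _ borel_measurable_power[OF measurable_disp]])
     (simp add: disp_nonneg disp_le_1 power_le_one)

end

section \<open>The upper bound: integrating over all empty boxes\<close>

text \<open>
  Jensen's inequality for \<open>x^N\<close> on the nonnegative reals. The tangent of \<open>x^N\<close> at the mean lies
  below the curve by Bernoulli's inequality.
\<close>

lemma (in prob_space) expectation_power_le:
  fixes Y :: "'a \<Rightarrow> real"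
  assumes Y: "integrable M Y" "integrable M (\<lambda>\<omega>. Y \<omega> ^ N)" and nn: "\<And>\<omega>. 0 \<le> Y \<omega>"
  shows "expectation Y ^ N \<le> expectation (\<lambda>\<omega>. Y \<omega> ^ N)"
proof (cases "expectation Y > 0 \<and> N > 0")
  case False
  moreover have "0 \<le> expectation Y" by (simp add: nn)
  ultimately consider "N = 0" | "expectation Y = 0" "N > 0" by fastforce
  then show ?thesis
  proof cases
    case 1 then show ?thesis by (simp add: prob_space)
  next
    case 2 then show ?thesis using nn by (simp add: zero_power)
  qed
next
  case True
  define A where "A = expectation Y"
  have A: "A > 0" using True by (simp add: A_def)
  have "A ^ N = expectation (\<lambda>\<omega>. A ^ N * (1 + real N * (Y \<omega> / A - 1)))"
    using Y(1) A by (simp add: prob_space A_def[symmetric])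
  also have "\<dots> \<le> expectation (\<lambda>\<omega>. Y \<omega> ^ N)"
  proof (rule integral_mono)
    fix \<omega>
    have "1 + real N * (Y \<omega> / A - 1) \<le> (1 + (Y \<omega> / A - 1)) ^ N"
      by (rule Bernoulli_inequality) (use A nn in auto)
    then have "A ^ N * (1 + real N * (Y \<omega> / A - 1)) \<le> A ^ N * (Y \<omega> / A) ^ N"
      using A by (intro mult_left_mono) auto
    also have "\<dots> = Y \<omega> ^ N" using A by (simp add: power_divide)
    finally show "A ^ N * (1 + real N * (Y \<omega> / A - 1)) \<le> Y \<omega> ^ N" .
  qed (use Y in auto)
  finally show ?thesis by (simp add: A_def)
qed

text \<open>
  In one coordinate, \<open>slot p \<alpha> \<beta>\<close> gives the subinterval \<open>[a, b]\<close> of \<open>(\<alpha>, \<beta>)\<close> the density \<open>(b - a)^p\<close>.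
  The strict inequalities keep the closed box \<open>[a, b]\<close> inside the open box \<open>(\<alpha>, \<beta>)\<close>.
\<close>

definition slot :: "nat \<Rightarrow> real \<Rightarrow> real \<Rightarrow> real \<Rightarrow> real \<Rightarrow> real" where
  "slot p \<alpha> \<beta> a b = (if \<alpha> < a \<and> a < b \<and> b < \<beta> then (b - a) ^ p else 0)"

lemma slot_nonneg: "0 \<le> slot p \<alpha> \<beta> a b"
  by (simp add: slot_def)

lemma slot_measurable [measurable]:
  "slot p \<alpha> \<beta> a \<in> borel_measurable borel"
  "(\<lambda>z. slot p \<alpha> \<beta> (fst z) (snd z)) \<in> borel_measurable (borel \<Otimes>\<^sub>M borel)"
  unfolding slot_def by measurable

lemma nn_integral_slot:
  assumes "\<alpha> \<le> \<beta>"
  shows "(\<integral>\<^sup>+a. \<integral>\<^sup>+b. slot p \<alpha> \<beta> a b \<partial>lborel \<partial>lborel) = ennreal ((\<beta> - \<alpha>) ^ (p + 2) / ((real p + 1) * (real p + 2)))"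
proof -
  have inner: "(\<integral>\<^sup>+b. slot p \<alpha> \<beta> a b \<partial>lborel) = ennreal ((\<beta> - a) ^ (p + 1) / (real p + 1)) * indicator {\<alpha>..\<beta>} a"
    if a: "a \<noteq> \<alpha>" for a
  proof (cases "\<alpha> < a \<and> a \<le> \<beta>")
    case True
    have "(\<integral>\<^sup>+b. slot p \<alpha> \<beta> a b \<partial>lborel) = (\<integral>\<^sup>+b. ennreal ((b - a) ^ p) * indicator {a..\<beta>} b \<partial>lborel)"
    proof (rule nn_integral_cong_AE)
      have "AE b in lborel. b \<noteq> a \<and> b \<noteq> \<beta>"
        by (intro AE_conjI AE_lborel_singleton)
      then show "AE b in lborel. ennreal (slot p \<alpha> \<beta> a b) = ennreal ((b - a) ^ p) * indicator {a..\<beta>} b"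
        by eventually_elim (use True in \<open>auto simp: slot_def indicator_def\<close>)
    qed
    also have "\<dots> = ennreal ((\<beta> - a) ^ (p + 1) / (real p + 1) - (a - a) ^ (p + 1) / (real p + 1))"
    proof (rule nn_integral_FTC_Icc)
      fix b
      have "((\<lambda>b. (b - a) ^ m / m) has_real_derivative (real m * (b - a) ^ (m - 1)) / m) (at b)" for m
        by (auto intro!: derivative_eq_intros)
      from this[of "p + 1"]
      show "((\<lambda>b. (b - a) ^ (p + 1) / (real p + 1)) has_real_derivative (b - a) ^ p) (at b)"
        by (simp add: add.commute del: power_Suc)
    qed (use True in auto)
    finally show ?thesis using True by simp
  next
    case False
    then have "slot p \<alpha> \<beta> a b = 0" for b by (auto simp: slot_def)
    with False a show ?thesis by (auto simp: indicator_def)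
  qed
  have "(\<integral>\<^sup>+a. \<integral>\<^sup>+b. slot p \<alpha> \<beta> a b \<partial>lborel \<partial>lborel)
      = (\<integral>\<^sup>+a. ennreal ((\<beta> - a) ^ (p + 1) / (real p + 1)) * indicator {\<alpha>..\<beta>} a \<partial>lborel)"
    by (rule nn_integral_cong_AE, rule AE_mp[OF AE_lborel_singleton[of \<alpha>]], rule AE_I2, rule impI, erule inner)
  also have "\<dots> = ennreal (- ((\<beta> - \<beta>) ^ (p + 2) / ((real p + 1) * (real p + 2))) - - ((\<beta> - \<alpha>) ^ (p + 2) / ((real p + 1) * (real p + 2))))"
  proof (rule nn_integral_FTC_Icc)
    fix x :: real
    have "((\<lambda>x. - ((\<beta> - x) ^ m / ((real p + 1) * (real p + 2)))) has_real_derivative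
            real m * (\<beta> - x) ^ (m - 1) / ((real p + 1) * (real p + 2))) (at x)" for m
      by (auto intro!: derivative_eq_intros)
    from this[of "p + 2"]
    show "((\<lambda>x. - ((\<beta> - x) ^ (p + 2) / ((real p + 1) * (real p + 2)))) has_real_derivative
            (\<beta> - x) ^ (p + 1) / (real p + 1)) (at x)"
      by (simp add: add.commute[of 2] add.commute[of 1] del: power_Suc)
  qed (use assms in auto)
  finally show ?thesis by simp
qed

lemma vec_nth_measurable [measurable]: "(\<lambda>x::real^'d. x $ k) \<in> borel_measurable borel"
  by (intro borel_measurable_continuous_onI continuous_intros)

lemma slot_vec_measurable [measurable]:
  "(\<lambda>z::(real^'d) \<times> (real^'d). slot p \<alpha> \<beta> (fst z $ k) (snd z $ k)) \<in> borel_measurable (borel \<Otimes>\<^sub>M borel)"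
  unfolding slot_def by measurable

text \<open>
  The pairs \<open>(a\<^sub>k, b\<^sub>k)\<close> of different coordinates are independent of each other in this integral,
  so it factorizes. Integrating over \<open>b\<close> first, for fixed \<open>a\<close>, makes each of the two steps a product integral.
\<close>

lemma nn_integral_prod_slot:
  fixes \<alpha> \<beta> :: "real ^ 'd"
  assumes "\<And>k. \<alpha> $ k \<le> \<beta> $ k"
  shows "(\<integral>\<^sup>+z. (\<Prod>k\<in>UNIV. slot p (\<alpha> $ k) (\<beta> $ k) (fst z $ k) (snd z $ k)) \<partial>(lborel \<Otimes>\<^sub>M lborel))
    = ennreal ((\<Prod>k\<in>UNIV. \<beta> $ k - \<alpha> $ k) ^ (p + 2) / ((real p + 1) * (real p + 2)) ^ CARD('d))"
proof -
  have m: "(\<lambda>a. \<integral>\<^sup>+b. slot p \<alpha> \<beta> a b \<partial>lborel) \<in> borel_measurable borel" for \<alpha> \<beta>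
  proof -
    have "(\<lambda>z. ennreal (slot p \<alpha> \<beta> (fst z) (snd z))) \<in> borel_measurable (borel \<Otimes>\<^sub>M lborel)" by measurable
    from lborel.borel_measurable_nn_integral_fst[OF this] show ?thesis by simp
  qed
  have "(\<integral>\<^sup>+z. (\<Prod>k\<in>UNIV. slot p (\<alpha> $ k) (\<beta> $ k) (fst z $ k) (snd z $ k)) \<partial>(lborel \<Otimes>\<^sub>M lborel))
    = (\<integral>\<^sup>+(a::real^'d). \<integral>\<^sup>+(b::real^'d). (\<Prod>k\<in>UNIV. slot p (\<alpha> $ k) (\<beta> $ k) (a $ k) (b $ k)) \<partial>lborel \<partial>lborel)"
    by (subst lborel.nn_integral_fst[symmetric]) auto
  also have "\<dots> = (\<integral>\<^sup>+(a::real^'d). (\<Prod>k\<in>UNIV. \<integral>\<^sup>+b. slot p (\<alpha> $ k) (\<beta> $ k) (a $ k) b \<partial>lborel) \<partial>lborel)"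
    by (subst nn_integral_lborel_vec_prod[symmetric]) (auto simp: prod_ennreal slot_nonneg)
  also have "\<dots> = (\<Prod>k\<in>UNIV. \<integral>\<^sup>+a. \<integral>\<^sup>+b. slot p (\<alpha> $ k) (\<beta> $ k) a b \<partial>lborel \<partial>lborel)"
    by (subst nn_integral_lborel_vec_prod[symmetric]) (auto simp: m)
  also have "\<dots> = (\<Prod>k\<in>UNIV. ennreal ((\<beta> $ k - \<alpha> $ k) ^ (p + 2) / ((real p + 1) * (real p + 2))))"
    using assms by (subst nn_integral_slot) auto
  also have "\<dots> = ennreal (\<Prod>k\<in>UNIV. (\<beta> $ k - \<alpha> $ k) ^ (p + 2) / ((real p + 1) * (real p + 2)))"
    using assms by (intro prod_ennreal) (auto intro!: divide_nonneg_nonneg zero_le_power)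
  also have "(\<Prod>k\<in>UNIV. (\<beta> $ k - \<alpha> $ k) ^ (p + 2) / ((real p + 1) * (real p + 2)))
    = (\<Prod>k\<in>UNIV. \<beta> $ k - \<alpha> $ k) ^ (p + 2) / ((real p + 1) * (real p + 2)) ^ CARD('d)"
    by (simp add: prod_dividef prod_power_distrib del: power_Suc)
  finally show ?thesis .
qed

text \<open>
  From \<open>(1 - v)^n \<le> exp (- n v)\<close> and the fact that \<open>v^s exp (- n v)\<close> is largest at \<open>v = s/n\<close>.
\<close>

lemma power_mult_one_minus_le:
  fixes v :: real
  assumes "0 \<le> v" "v \<le> 1" "n > 0"
  shows "v ^ s * (1 - v) ^ n \<le> (real s / (exp 1 * real n)) ^ s"
proof (cases "s = 0")
  case True
  then show ?thesis using assms by (simp add: power_le_one)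
next
  case False
  define u where "u = real n * v / real s"
  have "u \<le> exp (u - 1)" using exp_ge_add_one_self[of "u - 1"] by simp
  moreover have "0 \<le> u" using assms by (simp add: u_def)
  ultimately have "u ^ s \<le> exp (u - 1) ^ s" by (rule power_mono)
  also have "\<dots> = exp (real s * (u - 1))" by (rule exp_of_nat_mult[symmetric])
  also have "real s * (u - 1) = real n * v - real s" using False by (simp add: u_def field_simps)
  finally have us: "u ^ s \<le> exp (real n * v - real s)" .
  have "1 - v \<le> exp (- v)" using exp_ge_add_one_self[of "- v"] by simp
  then have "(1 - v) ^ n \<le> exp (- v) ^ n" using assms by (intro power_mono) auto
  also have "\<dots> = exp (real n * (- v))" by (rule exp_of_nat_mult[symmetric])
  finally have ve: "(1 - v) ^ n \<le> exp (- (real n * v))" by simp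
  have "v = real s / real n * u" using False assms by (simp add: u_def)
  then have "v ^ s * (1 - v) ^ n = (real s / real n) ^ s * (u ^ s * (1 - v) ^ n)"
    by (metis mult.assoc power_mult_distrib)
  also have "u ^ s * (1 - v) ^ n \<le> exp (real n * v - real s) * exp (- (real n * v))"
    using us ve assms \<open>0 \<le> u\<close> by (intro mult_mono) auto
  also have "\<dots> = exp (- real s)" by (simp flip: exp_add)
  also have "\<dots> = (1 / exp 1) ^ s" by (simp add: exp_minus power_one_over inverse_eq_divide exp_of_nat_mult[of s 1, simplified])
  also have "(real s / real n) ^ s * (1 / exp 1) ^ s = (real s / (exp 1 * real n)) ^ s"
    by (simp add: mult.commute flip: power_mult_distrib)
  finally show ?thesis by (simp add: mult_left_mono)
qed

text \<open>
  For a pair of corners \<open>z = (a, b)\<close> inside the cube this is \<open>V^p\<close>, where \<open>V\<close> is the volume of the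
  box \<open>[a, b]\<close>; see \<open>weight_eq\<close>. For all other pairs it vanishes.
\<close>

definition weight :: "nat \<Rightarrow> (real ^ 'd) \<times> (real ^ 'd) \<Rightarrow> real" where
  "weight p z = (\<Prod>k\<in>UNIV. slot p 0 1 (fst z $ k) (snd z $ k))"

lemma weight_nonneg: "0 \<le> weight p z"
  unfolding weight_def by (intro prod_nonneg) (simp add: slot_nonneg)

lemma weight_measurable [measurable]: "weight p \<in> borel_measurable (borel \<Otimes>\<^sub>M borel)"
  unfolding weight_def by measurable

lemma nn_integral_weight:
  "(\<integral>\<^sup>+z. weight p (z :: (real ^ 'd) \<times> (real ^ 'd)) \<partial>(lborel \<Otimes>\<^sub>M lborel)) = ennreal (1 / ((real p + 1) * (real p + 2)) ^ CARD('d))"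
  using nn_integral_prod_slot[of "0 :: real ^ 'd" 1 p] by (simp add: weight_def)

lemma weight_eq:
  fixes a b :: "real ^ 'd"
  shows "weight p (a, b) = (if \<forall>k. 0 < a $ k \<and> a $ k < b $ k \<and> b $ k < 1 then (\<Prod>k\<in>UNIV. b $ k - a $ k) ^ p else 0)"
proof (cases "\<forall>k. 0 < a $ k \<and> a $ k < b $ k \<and> b $ k < 1")
  case True
  then have "weight p (a, b) = (\<Prod>k\<in>UNIV. (b $ k - a $ k) ^ p)"
    unfolding weight_def by (intro prod.cong) (auto simp: slot_def)
  with True show ?thesis by (simp add: prod_power_distrib)
next
  case False
  then obtain k where "\<not> (0 < a $ k \<and> a $ k < b $ k \<and> b $ k < 1)" by blast
  then have "weight p (a, b) = 0"
    unfolding weight_def by (intro prod_zero bexI[of _ k]) (auto simp: slot_def)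
  with False show ?thesis by auto
qed

text \<open>
  All boxes inside an empty box are empty, so the integral over all empty boxes is at least the
  integral over the sub-boxes of any single empty one. The latter is a power of its volume.
\<close>

lemma disp_power_le:
  fixes x :: "nat \<Rightarrow> real ^ 'd"
  shows "ennreal (disp n x ^ (p + 2)) \<le> ennreal (((real p + 1) * (real p + 2)) ^ CARD('d)) *
     (\<integral>\<^sup>+z. ennreal (weight p z) * indicator {z. \<forall>i\<in>{1..n}. x i \<notin> cbox (fst z) (snd z)} z \<partial>(lborel \<Otimes>\<^sub>M lborel))"
    (is "_ \<le> ennreal ?K * ?J")
proof -
  have "?J \<le> (\<integral>\<^sup>+z. weight p (z :: (real ^ 'd) \<times> (real ^ 'd)) \<partial>(lborel \<Otimes>\<^sub>M lborel))"
    by (intro nn_integral_mono) (simp add: indicator_def)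
  then have "?J < top" unfolding nn_integral_weight by (simp add: le_less_trans)
  then obtain j where j: "?J = ennreal j" "0 \<le> j"
    by (cases ?J) auto
  have K: "0 < ?K" by simp
  have "disp n x \<le> root (p + 2) (?K * j)"
  proof (rule disp_le_boxes)
    fix a b :: "real ^ 'd"
    assume ab: "cube_corners a b" "box a b \<inter> x ` {1..n} = {}"
    let ?V = "\<Prod>k\<in>UNIV. b $ k - a $ k"
    have V: "0 \<le> ?V" using cube_cornersD(4)[OF ab(1)] by (intro prod_nonneg) simp
    have "ennreal (?V ^ (p + 2) / ?K)
      = (\<integral>\<^sup>+z. (\<Prod>k\<in>UNIV. slot p (a $ k) (b $ k) (fst z $ k) (snd z $ k)) \<partial>(lborel \<Otimes>\<^sub>M lborel))"
      using cube_cornersD(2)[OF ab(1)] by (subst nn_integral_prod_slot) simp_all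
    also have "\<dots> \<le> ?J"
    proof (rule nn_integral_mono)
      fix z :: "(real ^ 'd) \<times> (real ^ 'd)"
      show "ennreal (\<Prod>k\<in>UNIV. slot p (a $ k) (b $ k) (fst z $ k) (snd z $ k))
         \<le> ennreal (weight p z) * indicator {z. \<forall>i\<in>{1..n}. x i \<notin> cbox (fst z) (snd z)} z"
      proof (cases "\<forall>k. a $ k < fst z $ k \<and> fst z $ k < snd z $ k \<and> snd z $ k < b $ k")
        case True
        have "slot p (a $ k) (b $ k) (fst z $ k) (snd z $ k) \<le> slot p 0 1 (fst z $ k) (snd z $ k)" for k
          using True[rule_format, of k] cube_cornersD(1,3)[OF ab(1), of k] by (auto simp: slot_def)
        then have "(\<Prod>k\<in>UNIV. slot p (a $ k) (b $ k) (fst z $ k) (snd z $ k)) \<le> weight p z"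
          unfolding weight_def by (intro prod_mono) (simp add: slot_nonneg)
        moreover have "cbox (fst z) (snd z) \<subseteq> box a b"
        proof
          fix y assume y: "y \<in> cbox (fst z) (snd z)"
          have "a $ k < y $ k \<and> y $ k < b $ k" for k
            using True[rule_format, of k] y[unfolded mem_box_cart, rule_format, of k] by linarith
          then show "y \<in> box a b" by (simp add: mem_box_cart)
        qed
        ultimately show ?thesis
          using ab(2) by (auto simp: indicator_def ennreal_leI)
      next
        case False
        then obtain k where "\<not> (a $ k < fst z $ k \<and> fst z $ k < snd z $ k \<and> snd z $ k < b $ k)" by blast
        then have "(\<Prod>k\<in>UNIV. slot p (a $ k) (b $ k) (fst z $ k) (snd z $ k)) = 0"
          by (intro prod_zero bexI[of _ k]) (auto simp: slot_def)
        then show ?thesis by (simp only: ennreal_0 zero_le)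
      qed
    qed
    finally have "?V ^ (p + 2) / ?K \<le> j" unfolding j(1) using j(2) by simp
    then have "?V ^ (p + 2) \<le> ?K * j" using K by (simp add: divide_le_eq mult.commute)
    then have "root (p + 2) (?V ^ (p + 2)) \<le> root (p + 2) (?K * j)" by simp
    then show "?V \<le> root (p + 2) (?K * j)" using V by (simp add: real_root_power_cancel del: power_Suc)
  qed
  then have "disp n x ^ (p + 2) \<le> root (p + 2) (?K * j) ^ (p + 2)"
    by (intro power_mono disp_nonneg)
  also have "\<dots> = ?K * j" using j(2) by (intro real_root_pow_pos2) auto
  finally have "ennreal (disp n x ^ (p + 2)) \<le> ennreal (?K * j)" by (rule ennreal_leI)
  then show ?thesis unfolding j(1) using j(2) by (simp add: ennreal_mult)
qed

context uniform_sample
begin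

lemma sets_avoid:
  assumes "K \<in> sets borel"
  shows "{\<omega> \<in> space M. \<forall>i\<in>{1..n}. X i \<omega> \<notin> K} \<in> sets M"
proof -
  have "{\<omega> \<in> space M. \<forall>i\<in>{1..n}. X i \<omega> \<in> - K} \<in> sets M"
    using assms by (intro sets.sets_Collect_finite_All measurable_sets_Collect[OF measurable_X]) auto
  then show ?thesis by simp
qed

lemma emeasure_avoid:
  assumes "cube_corners a b"
  shows "emeasure M {\<omega> \<in> space M. \<forall>i\<in>{1..n}. X i \<omega> \<notin> cbox a b} = ennreal ((1 - (\<Prod>k\<in>UNIV. b $ k - a $ k)) ^ n)"
proof -
  let ?A = "{\<omega> \<in> space M. \<forall>i\<in>{1..n}. X i \<omega> \<notin> cbox a b}"
  have A: "?A \<in> sets M"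
    by (rule sets_avoid) simp
  have "prob ?A = expectation (indicator ?A)"
    using A by simp
  also have "\<dots> = expectation (\<lambda>\<omega>. \<Prod>i\<in>{1..n}. indicator (- cbox a b) (X i \<omega>))"
  proof (rule Bochner_Integration.integral_cong[OF refl])
    fix \<omega> assume "\<omega> \<in> space M"
    then show "indicator ?A \<omega> = (\<Prod>i\<in>{1..n}. indicator (- cbox a b) (X i \<omega>) :: real)"
      by (cases "\<omega> \<in> ?A") (auto intro!: prod_zero[symmetric] simp: indicator_def)
  qed
  also have "\<dots> = (1 - (\<Prod>k\<in>UNIV. b $ k - a $ k)) ^ n"
    by (subst expectation_avoid) (simp_all only: measure_unit_cube_box[OF assms], simp)
  finally show ?thesis by (simp add: emeasure_eq_measure)
qed

text \<open>
  Exchanging expectation and integral in \<open>disp_power_le\<close> replaces the event that \<open>[a, b]\<close> is empty by its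
  probability \<open>(1 - V)^n\<close>. Of the \<open>q + s\<close> factors \<open>V\<close> in the weight, \<open>s\<close> are spent against this
  probability; the other \<open>q\<close> are integrated exactly. This integral divides the constant of
  \<open>disp_power_le\<close>, so that only the quotient of two such constants remains.
\<close>

lemma expectation_disp_power_le:
  assumes "n > 0"
  shows "expectation (\<lambda>\<omega>. disp n (\<lambda>i. X i \<omega>) ^ (q + s + 2))
     \<le> (real s / (exp 1 * real n)) ^ s * ((real (q + s) + 1) * (real (q + s) + 2) / ((real q + 1) * (real q + 2))) ^ CARD('d)"
proof -
  define p where "p = q + s"
  define c where "c = (real s / (exp 1 * real n)) ^ s"
  have c: "0 \<le> c" by (simp add: c_def)
  let ?K = "\<lambda>p. ((real p + 1) * (real p + 2)) ^ CARD('d)"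
  let ?I = "\<lambda>\<omega> (z :: (real ^ 'd) \<times> (real ^ 'd)). ennreal (weight p z) * indicator {z. \<forall>i\<in>{1..n}. X i \<omega> \<notin> cbox (fst z) (snd z)} z"
  have sf: "sigma_finite_measure (lborel \<Otimes>\<^sub>M lborel :: ((real ^ 'd) \<times> (real ^ 'd)) measure)"
    unfolding lborel_prod by (rule lborel.sigma_finite_measure_axioms)
  interpret pair_sigma_finite M "lborel \<Otimes>\<^sub>M lborel :: ((real ^ 'd) \<times> (real ^ 'd)) measure"
    unfolding lborel_prod by (simp add: pair_sigma_finite_def lborel.sigma_finite_measure_axioms sigma_finite_measure_axioms)
  have pm1: "Measurable.pred (M \<Otimes>\<^sub>M (lborel \<Otimes>\<^sub>M lborel))
      (\<lambda>y :: 'a \<times> (real ^ 'd) \<times> (real ^ 'd). fst (snd y) $ k \<le> X i (fst y) $ k \<and> X i (fst y) $ k \<le> snd (snd y) $ k)"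
    if "i \<in> {1..n}" for i k
  proof -
    note [measurable] = measurable_X[OF that]
    show ?thesis by measurable
  qed
  have pm: "Measurable.pred (M \<Otimes>\<^sub>M (lborel \<Otimes>\<^sub>M lborel))
      (\<lambda>y. \<forall>i\<in>{1..n}. \<not> (\<forall>k. fst (snd y) $ k \<le> X i (fst y) $ k \<and> X i (fst y) $ k \<le> snd (snd y) $ k))"
    by (intro pred_intros_finite(2,3) pred_intros_logic(2) pm1) simp_all
  have "(\<lambda>y. if \<forall>i\<in>{1..n}. \<not> (\<forall>k. fst (snd y) $ k \<le> X i (fst y) $ k \<and> X i (fst y) $ k \<le> snd (snd y) $ k)
      then ennreal (weight p (snd y)) else 0) \<in> borel_measurable (M \<Otimes>\<^sub>M (lborel \<Otimes>\<^sub>M lborel))"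
    by (rule measurable_If[OF _ _ pm[unfolded pred_def]]) measurable
  also have "(\<lambda>y. if \<forall>i\<in>{1..n}. \<not> (\<forall>k. fst (snd y) $ k \<le> X i (fst y) $ k \<and> X i (fst y) $ k \<le> snd (snd y) $ k)
      then ennreal (weight p (snd y)) else 0) = (\<lambda>(\<omega>, z). ?I \<omega> z)"
    by (auto simp: fun_eq_iff indicator_def mem_box_cart)
  finally have I_meas: "(\<lambda>(\<omega>, z). ?I \<omega> z) \<in> borel_measurable (M \<Otimes>\<^sub>M (lborel \<Otimes>\<^sub>M lborel))" .
  have "ennreal (expectation (\<lambda>\<omega>. disp n (\<lambda>i. X i \<omega>) ^ (p + 2))) = (\<integral>\<^sup>+\<omega>. ennreal (disp n (\<lambda>i. X i \<omega>) ^ (p + 2)) \<partial>M)"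
    by (rule nn_integral_eq_integral[symmetric, OF integrable_disp_power]) (simp add: disp_nonneg)
  also have "\<dots> \<le> (\<integral>\<^sup>+\<omega>. ennreal (?K p) * (\<integral>\<^sup>+z. ?I \<omega> z \<partial>(lborel \<Otimes>\<^sub>M lborel)) \<partial>M)"
    by (intro nn_integral_mono disp_power_le)
  also have "\<dots> = ennreal (?K p) * (\<integral>\<^sup>+\<omega>. (\<integral>\<^sup>+z. ?I \<omega> z \<partial>(lborel \<Otimes>\<^sub>M lborel)) \<partial>M)"
    using sigma_finite_measure.borel_measurable_nn_integral_fst[OF sf I_meas] by (intro nn_integral_cmult) simp
  also have "(\<integral>\<^sup>+\<omega>. (\<integral>\<^sup>+z. ?I \<omega> z \<partial>(lborel \<Otimes>\<^sub>M lborel)) \<partial>M) = (\<integral>\<^sup>+z. (\<integral>\<^sup>+\<omega>. ?I \<omega> z \<partial>M) \<partial>(lborel \<Otimes>\<^sub>M lborel))"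
    by (rule Fubini'[OF I_meas, symmetric])
  also have "\<dots> \<le> (\<integral>\<^sup>+z. ennreal c * ennreal (weight q (z :: (real ^ 'd) \<times> (real ^ 'd))) \<partial>(lborel \<Otimes>\<^sub>M lborel))"
  proof (rule nn_integral_mono)
    fix z :: "(real ^ 'd) \<times> (real ^ 'd)"
    obtain a b where z: "z = (a, b)" by (cases z)
    show "(\<integral>\<^sup>+\<omega>. ?I \<omega> z \<partial>M) \<le> ennreal c * ennreal (weight q z)"
    proof (cases "\<forall>k. 0 < a $ k \<and> a $ k < b $ k \<and> b $ k < 1")
      case True
      then have cc: "cube_corners a b" by (auto simp: cube_corners_def intro: less_imp_le)
      define V where "V = (\<Prod>k\<in>UNIV. b $ k - a $ k)"
      have V: "0 \<le> V" "V \<le> 1"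
        unfolding V_def using cube_cornersD(4,5)[OF cc] by (auto intro!: prod_nonneg prod_le_1)
      have sets: "{\<omega> \<in> space M. \<forall>i\<in>{1..n}. X i \<omega> \<notin> cbox a b} \<in> sets M"
        by (rule sets_avoid) simp
      have "(\<integral>\<^sup>+\<omega>. ?I \<omega> z \<partial>M) = (\<integral>\<^sup>+\<omega>. ennreal (weight p z) * indicator {\<omega> \<in> space M. \<forall>i\<in>{1..n}. X i \<omega> \<notin> cbox a b} \<omega> \<partial>M)"
        by (intro nn_integral_cong) (auto simp: indicator_def z)
      also have "\<dots> = ennreal (weight p z) * ennreal ((1 - V) ^ n)"
        unfolding V_def using sets emeasure_avoid[OF cc] by (subst nn_integral_cmult_indicator) simp_all
      also have "\<dots> = ennreal (V ^ p * (1 - V) ^ n)"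
        using True V by (simp add: z weight_eq V_def[symmetric] ennreal_mult)
      also have "V ^ p * (1 - V) ^ n = V ^ q * (V ^ s * (1 - V) ^ n)"
        by (simp add: p_def power_add)
      also have "ennreal \<dots> \<le> ennreal (V ^ q * c)"
        unfolding c_def using V assms by (intro ennreal_leI mult_left_mono power_mult_one_minus_le) auto
      also have "\<dots> = ennreal c * ennreal (weight q z)"
        using True V c by (simp add: z weight_eq V_def[symmetric] ennreal_mult mult.commute)
      finally show ?thesis .
    next
      case False
      then have "weight p z = 0" unfolding z weight_eq by (simp only: if_False)
      then show ?thesis by simp
    qed
  qed
  also have "\<dots> = ennreal c * (\<integral>\<^sup>+z. ennreal (weight q (z :: (real ^ 'd) \<times> (real ^ 'd))) \<partial>(lborel \<Otimes>\<^sub>M lborel))"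
    by (intro nn_integral_cmult) simp
  also have "\<dots> = ennreal c * ennreal (1 / ?K q)"
    unfolding nn_integral_weight ..
  finally have "ennreal (expectation (\<lambda>\<omega>. disp n (\<lambda>i. X i \<omega>) ^ (p + 2))) \<le> ennreal (?K p) * (ennreal c * ennreal (1 / ?K q))"
    by (simp add: mult_left_mono)
  also have "\<dots> = ennreal (?K p * (c * (1 / ?K q)))"
  proof -
    have "0 \<le> ?K p" "0 \<le> 1 / ?K q" by simp_all
    with c show ?thesis by (simp only: ennreal_mult mult_nonneg_nonneg)
  qed
  finally have "expectation (\<lambda>\<omega>. disp n (\<lambda>i. X i \<omega>) ^ (p + 2)) \<le> ?K p * (c * (1 / ?K q))"
    using c by (subst (asm) ennreal_le_iff) auto
  also have "\<dots> = c * ((real p + 1) * (real p + 2) / ((real q + 1) * (real q + 2))) ^ CARD('d)"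
    by (simp add: power_divide)
  finally show ?thesis by (simp add: p_def c_def)
qed

end

section \<open>Lower bound by cutting points off a slab\<close>

text \<open>
  The share of a box that is lost when the point \<open>x\<close> is cut off. It is zero outside the slab
  \<open>0 < x\<^sub>0 < \<delta>\<close> (with \<open>x\<^sub>0\<close> the coordinate \<open>k0\<close>), where nothing has to be cut. Inside the slab it is
  the smallest of the other coordinates; the value \<open>1\<close> in place of \<open>x\<^sub>0\<close> covers the case of dimension one,
  in which the box must be given up. The truncation to \<open>[0, 1]\<close> makes the bounds of \<open>cut_le\<close> hold for all \<open>x\<close>.
\<close>

definition cut :: "'d \<Rightarrow> real \<Rightarrow> real ^ 'd \<Rightarrow> real" where
  "cut k0 \<delta> x = (if 0 < x $ k0 \<and> x $ k0 < \<delta>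
     then Min ((\<lambda>k. if k = k0 then 1 else max 0 (min 1 (x $ k))) ` UNIV) else 0)"

lemma cut_le:
  "0 \<le> cut k0 \<delta> x" "cut k0 \<delta> x \<le> 1"
proof -
  have "Min ((\<lambda>k. if k = k0 then 1 else max 0 (min 1 (x $ k))) ` UNIV) \<le> (if k0 = k0 then 1 else max 0 (min 1 (x $ k0)))"
    by (intro Min_le imageI) auto
  then show "cut k0 \<delta> x \<le> 1" by (simp add: cut_def)
  show "0 \<le> cut k0 \<delta> x" by (simp add: cut_def)
qed

lemma cut_measurable [measurable]: "cut k0 \<delta> \<in> borel_measurable borel"
  unfolding cut_def by measurable

text \<open>
  Induction over the points, keeping the upper corner \<open>\<beta>\<close>. A point that lies in the current box is removed by
  moving the lower face up to the point, in the coordinate where the point is lowest. If that face was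
  already above \<open>0\<close>, the remaining side \<open>1 - x\<^sub>k\<close> is even larger than \<open>(1 - c\<^sub>k) (1 - x\<^sub>k)\<close>.
\<close>

lemma empty_box_by_cutting:
  fixes x :: "nat \<Rightarrow> real ^ 'd" and k0 :: 'd
  assumes \<delta>: "0 \<le> \<delta>" "\<delta> \<le> 1"
  defines "\<beta> \<equiv> (\<chi> k. if k = k0 then \<delta> else 1) :: real ^ 'd"
  shows "\<exists>c. cube_corners c \<beta> \<and> box c \<beta> \<inter> x ` {1..n} = {} \<and>
    \<delta> * (\<Prod>i\<in>{1..n}. 1 - cut k0 \<delta> (x i)) \<le> (\<Prod>k\<in>UNIV. \<beta> $ k - c $ k)"
proof (induction n)
  case 0
  have "cube_corners 0 \<beta>" using \<delta> by (simp add: cube_corners_def \<beta>_def)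
  moreover have "(\<Prod>k\<in>UNIV. \<beta> $ k - (0 :: real ^ 'd) $ k) = \<delta>"
    by (simp add: \<beta>_def)
  ultimately show ?case by (intro exI[of _ 0]) simp
next
  case (Suc n)
  then obtain c where c: "cube_corners c \<beta>" "box c \<beta> \<inter> x ` {1..n} = {}"
    and le: "\<delta> * (\<Prod>i\<in>{1..n}. 1 - cut k0 \<delta> (x i)) \<le> (\<Prod>k\<in>UNIV. \<beta> $ k - c $ k)" by blast
  define h where "h = cut k0 \<delta> (x (Suc n))"
  have h: "0 \<le> h" "h \<le> 1" using cut_le by (auto simp: h_def)
  have set: "{1..Suc n} = insert (Suc n) {1..n}" by auto
  have prod: "\<delta> * (\<Prod>i\<in>{1..Suc n}. 1 - cut k0 \<delta> (x i)) \<le> (\<Prod>k\<in>UNIV. \<beta> $ k - c $ k) * (1 - h)"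
    using mult_right_mono[OF le, of "1 - h"] h by (simp add: h_def mult_ac)
  have nn: "0 \<le> (\<Prod>k\<in>UNIV. \<beta> $ k - c $ k)"
    using cube_cornersD(4)[OF c(1)] by (intro prod_nonneg) simp
  show ?case
  proof (cases "x (Suc n) \<in> box c \<beta>")
    case False
    have "(\<Prod>k\<in>UNIV. \<beta> $ k - c $ k) * (1 - h) \<le> (\<Prod>k\<in>UNIV. \<beta> $ k - c $ k)"
      using nn h by (simp add: mult_left_le)
    with prod have "\<delta> * (\<Prod>i\<in>{1..Suc n}. 1 - cut k0 \<delta> (x i)) \<le> (\<Prod>k\<in>UNIV. \<beta> $ k - c $ k)"
      by linarith
    then show ?thesis using c False unfolding set by blast
  next
    case True
    then have x: "c $ k < x (Suc n) $ k" "x (Suc n) $ k < \<beta> $ k" for k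
      by (auto simp: mem_box_cart)
    let ?y = "\<lambda>k. if k = k0 then 1 else max 0 (min 1 (x (Suc n) $ k))"
    have "Min (?y ` UNIV) \<in> ?y ` UNIV" by (intro Min_in) auto
    then obtain \<kappa> where \<kappa>: "Min (?y ` UNIV) = ?y \<kappa>" by blast
    have "0 < x (Suc n) $ k0" "x (Suc n) $ k0 < \<delta>"
      using x[of k0] cube_cornersD(1)[OF c(1), of k0] by (auto simp: \<beta>_def)
    then have h_eq: "h = ?y \<kappa>" unfolding h_def cut_def using \<kappa> by simp
    show ?thesis
    proof (cases "\<kappa> = k0")
      case True
      \<comment> \<open>Here the cut takes everything: the empty box with both corners at \<open>\<beta>\<close> has the required volume \<open>0\<close>.\<close>
      have "cube_corners \<beta> \<beta>" using \<delta> by (simp add: cube_corners_def \<beta>_def)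
      moreover have "box \<beta> \<beta> \<inter> x ` {1..Suc n} = {}" by (auto simp: mem_box_cart)
      moreover have "\<delta> * (\<Prod>i\<in>{1..Suc n}. 1 - cut k0 \<delta> (x i)) \<le> (\<Prod>k\<in>UNIV. \<beta> $ k - \<beta> $ k)"
        using prod h_eq True by (simp add: power_0_left)
      ultimately show ?thesis by blast
    next
      case False
      then have \<beta>\<kappa>: "\<beta> $ \<kappa> = 1" by (simp add: \<beta>_def)
      have c\<kappa>: "0 \<le> c $ \<kappa>" "c $ \<kappa> \<le> 1" using cube_cornersD(1,2)[OF c(1), of \<kappa>] \<beta>\<kappa> by auto
      have x\<kappa>: "c $ \<kappa> < x (Suc n) $ \<kappa>" "x (Suc n) $ \<kappa> < 1" using x[of \<kappa>] \<beta>\<kappa> by auto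
      have hx: "h = x (Suc n) $ \<kappa>" using h_eq False x\<kappa> c\<kappa> by simp
      define c' where "c' = (\<chi> k. if k = \<kappa> then x (Suc n) $ \<kappa> else c $ k)"
      have cc': "c $ k \<le> c' $ k" "c' $ k \<le> \<beta> $ k" for k
        using x[of k] cube_cornersD(2)[OF c(1), of k] by (auto simp: c'_def)
      have "cube_corners c' \<beta>"
        unfolding cube_corners_def
      proof (intro allI conjI)
        fix k show "0 \<le> c' $ k" "c' $ k \<le> \<beta> $ k" "\<beta> $ k \<le> 1"
          using cc'[of k] cube_cornersD(1,3)[OF c(1), of k] by linarith+
      qed
      moreover have "box c' \<beta> \<subseteq> box c \<beta>"
        using le_less_trans[OF cc'(1)] by (auto simp: mem_box_cart)
      moreover have "x (Suc n) \<notin> box c' \<beta>"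
        by (auto simp: mem_box_cart c'_def intro!: exI[of _ \<kappa>])
      moreover have "(\<Prod>k\<in>UNIV. \<beta> $ k - c $ k) * (1 - h) \<le> (\<Prod>k\<in>UNIV. \<beta> $ k - c' $ k)"
      proof -
        let ?R = "\<Prod>k\<in>UNIV - {\<kappa>}. \<beta> $ k - c $ k"
        have R: "0 \<le> ?R" using cube_cornersD(4)[OF c(1)] by (intro prod_nonneg) simp
        have "(\<Prod>k\<in>UNIV. \<beta> $ k - c $ k) = (1 - c $ \<kappa>) * ?R"
          by (subst prod.remove[of _ \<kappa>]) (auto simp: \<beta>\<kappa>)
        moreover have "(\<Prod>k\<in>UNIV. \<beta> $ k - c' $ k) = (1 - h) * (\<Prod>k\<in>UNIV - {\<kappa>}. \<beta> $ k - c' $ k)"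
          by (subst prod.remove[of _ \<kappa>]) (auto simp: \<beta>\<kappa> c'_def hx)
        moreover have "(\<Prod>k\<in>UNIV - {\<kappa>}. \<beta> $ k - c' $ k) = ?R"
          by (intro prod.cong) (auto simp: c'_def)
        moreover have "(1 - c $ \<kappa>) * ?R * (1 - h) \<le> 1 * ?R * (1 - h)"
          using R h c\<kappa> by (intro mult_right_mono) auto
        ultimately show ?thesis by (simp add: mult.commute)
      qed
      ultimately show ?thesis
        using c(2) prod unfolding set by (intro exI[of _ c']) auto
    qed
  qed
qed

lemma disp_ge_cut:
  fixes x :: "nat \<Rightarrow> real ^ 'd" and k0 :: 'd
  assumes \<delta>: "0 \<le> \<delta>" "\<delta> \<le> 1"
  shows "\<delta> * (\<Prod>i\<in>{1..n}. 1 - cut k0 \<delta> (x i)) \<le> disp n x"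
proof -
  obtain c where "cube_corners c (\<chi> k. if k = k0 then \<delta> else 1)"
    "box c (\<chi> k. if k = k0 then \<delta> else 1) \<inter> x ` {1..n} = {}"
    and le: "\<delta> * (\<Prod>i\<in>{1..n}. 1 - cut k0 \<delta> (x i)) \<le> (\<Prod>k\<in>UNIV. (\<chi> k. if k = k0 then \<delta> else 1) $ k - c $ k)"
    using empty_box_by_cutting[OF assms, of k0 x n] by blast
  from disp_ge_box[OF this(1,2)] le show ?thesis by (rule order_trans[rotated])
qed

lemma nn_integral_unit_cube:
  assumes [measurable]: "f \<in> borel_measurable borel"
  shows "(\<integral>\<^sup>+x. f x \<partial>uniform_measure lborel unit_cube) = (\<integral>\<^sup>+(x::real^'d). f x * indicator unit_cube x \<partial>lborel)"
  by (subst nn_integral_uniform_measure) (auto simp: emeasure_unit_cube divide_ennreal_def)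

text \<open>
  Layer-cake formula: a point of the slab satisfies \<open>t < cut x\<close> only if all its other
  coordinates exceed \<open>t\<close>, which has probability \<open>(1 - t)^(d - 1)\<close>; integrating over \<open>t\<close> gives \<open>1/d\<close>.
\<close>

lemma nn_integral_cut_le:
  fixes k0 :: "'d::finite"
  assumes \<delta>: "0 \<le> \<delta>" "\<delta> \<le> 1"
  shows "(\<integral>\<^sup>+x. ennreal (cut k0 \<delta> x) \<partial>uniform_measure lborel unit_cube) \<le> ennreal (\<delta> / real CARD('d))"
proof -
  let ?F = "\<lambda>(t::real) k (y::real). (if k = k0 then indicator {0..\<delta>} y else indicator {t..1} y) :: ennreal"
  have "(\<integral>\<^sup>+x. ennreal (cut k0 \<delta> x) \<partial>uniform_measure lborel unit_cube)
      = (\<integral>\<^sup>+(x::real^'d). ennreal (cut k0 \<delta> x) * indicator unit_cube x \<partial>lborel)"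
    by (rule nn_integral_unit_cube) measurable
  also have "\<dots> \<le> (\<integral>\<^sup>+(x::real^'d). \<integral>\<^sup>+t. indicator {0..1} t * (\<Prod>k\<in>UNIV. ?F t k (x $ k)) \<partial>lborel \<partial>lborel)"
  proof (rule nn_integral_mono)
    fix x :: "real ^ 'd"
    show "ennreal (cut k0 \<delta> x) * indicator unit_cube x \<le> (\<integral>\<^sup>+t. indicator {0..1} t * (\<Prod>k\<in>UNIV. ?F t k (x $ k)) \<partial>lborel)"
    proof (cases "x \<in> unit_cube \<and> 0 < x $ k0 \<and> x $ k0 < \<delta>")
      case True
      then have cube: "0 \<le> x $ k" "x $ k \<le> 1" for k by (auto simp: unit_cube_def)
      have "cut k0 \<delta> x \<le> x $ k" if "k \<noteq> k0" for k
      proof -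
        have "Min ((\<lambda>k. if k = k0 then 1 else max 0 (min 1 (x $ k))) ` UNIV) \<le> (if k = k0 then 1 else max 0 (min 1 (x $ k)))"
          by (intro Min_le imageI) auto
        then show ?thesis using that True cube[of k] by (simp add: cut_def)
      qed
      then have "indicator {0..cut k0 \<delta> x} t \<le> indicator {0..1} t * (\<Prod>k\<in>UNIV. ?F t k (x $ k))" for t
      proof (cases "t \<in> {0..cut k0 \<delta> x}")
        assume t: "t \<in> {0..cut k0 \<delta> x}"
          and le: "\<And>k. k \<noteq> k0 \<Longrightarrow> cut k0 \<delta> x \<le> x $ k"
        have "?F t k (x $ k) = 1" for k
        proof (cases "k = k0")
          assume "k \<noteq> k0"
          with le[OF this] t cube[of k] show ?thesis by simp
        qed (use True in simp)
        moreover have "t \<le> 1" using t cut_le(2)[of k0 \<delta> x] by simp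
        ultimately show ?thesis using t by (simp add: prod.neutral)
      qed simp
      then have "(\<integral>\<^sup>+t. indicator {0..cut k0 \<delta> x} t \<partial>lborel) \<le> (\<integral>\<^sup>+t. indicator {0..1} t * (\<Prod>k\<in>UNIV. ?F t k (x $ k)) \<partial>lborel)"
        by (intro nn_integral_mono)
      moreover have "(\<integral>\<^sup>+t. indicator {0..cut k0 \<delta> x} t \<partial>lborel) = ennreal (cut k0 \<delta> x)"
        using cut_le(1)[of k0 \<delta> x] by (simp add: nn_integral_indicator)
      ultimately show ?thesis using True by simp
    next
      case False
      then show ?thesis by (auto simp: cut_def)
    qed
  qed
  also have "\<dots> = (\<integral>\<^sup>+t. \<integral>\<^sup>+(x::real^'d). indicator {0..1} t * (\<Prod>k\<in>UNIV. ?F t k (x $ k)) \<partial>lborel \<partial>lborel)"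
  proof (rule lborel_pair.Fubini'[symmetric])
    have "(\<lambda>z::(real^'d) \<times> real. indicator {0..1} (snd z) * (\<Prod>k\<in>UNIV. if k = k0 then indicator {0..\<delta>} (fst z $ k)
         else (if snd z \<le> fst z $ k \<and> fst z $ k \<le> 1 then 1 else 0)) :: ennreal) \<in> borel_measurable (lborel \<Otimes>\<^sub>M lborel)"
      by measurable
    also have "(\<lambda>z::(real^'d) \<times> real. indicator {0..1} (snd z) * (\<Prod>k\<in>UNIV. if k = k0 then indicator {0..\<delta>} (fst z $ k)
         else (if snd z \<le> fst z $ k \<and> fst z $ k \<le> 1 then 1 else 0)) :: ennreal) = (\<lambda>(x, t). indicator {0..1} t * (\<Prod>k\<in>UNIV. ?F t k (x $ k)))"
      by (auto simp: fun_eq_iff indicator_def intro!: prod.cong)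
    finally show "(\<lambda>(x::real^'d, t). indicator {0..1} t * (\<Prod>k\<in>UNIV. ?F t k (x $ k))) \<in> borel_measurable (lborel \<Otimes>\<^sub>M lborel)" .
  qed
  also have "\<dots> = (\<integral>\<^sup>+t. ennreal (\<delta> * (1 - t) ^ (CARD('d) - 1)) * indicator {0..1} t \<partial>lborel)"
  proof (rule nn_integral_cong)
    fix t :: real
    show "(\<integral>\<^sup>+(x::real^'d). indicator {0..1} t * (\<Prod>k\<in>UNIV. ?F t k (x $ k)) \<partial>lborel) = ennreal (\<delta> * (1 - t) ^ (CARD('d) - 1)) * indicator {0..1} t"
    proof (cases "t \<in> {0..1}")
      case True
      then have t: "0 \<le> t" "t \<le> 1" by auto
      have "(\<integral>\<^sup>+(x::real^'d). (\<Prod>k\<in>UNIV. ?F t k (x $ k)) \<partial>lborel) = (\<Prod>k\<in>UNIV. \<integral>\<^sup>+y. ?F t k y \<partial>lborel)"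
        by (rule nn_integral_lborel_vec_prod) (auto split: if_split)
      also have "\<dots> = (\<Prod>k\<in>UNIV. if k = k0 then ennreal \<delta> else ennreal (1 - t))"
        using t \<delta> by (intro prod.cong) (auto simp: nn_integral_indicator)
      also have "\<dots> = ennreal \<delta> * ennreal (1 - t) ^ (CARD('d) - 1)"
        by (subst prod.remove[of _ k0]) (auto simp: card_Diff_singleton)
      also have "\<dots> = ennreal (\<delta> * (1 - t) ^ (CARD('d) - 1))"
        using t \<delta> by (simp add: ennreal_mult ennreal_power)
      finally show ?thesis using True by simp
    qed simp
  qed
  also have "\<dots> = ennreal (- (\<delta> * (1 - 1) ^ CARD('d) / real CARD('d)) - - (\<delta> * (1 - 0) ^ CARD('d) / real CARD('d)))"
  proof (rule nn_integral_FTC_Icc)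
    fix t :: real
    have "((\<lambda>t. - (\<delta> * (1 - t) ^ m / real m)) has_real_derivative (\<delta> * (real m * (1 - t) ^ (m - 1)) / real m)) (at t)" for m
      by (auto intro!: derivative_eq_intros)
    from this[of "CARD('d)"]
    show "((\<lambda>t. - (\<delta> * (1 - t) ^ CARD('d) / real CARD('d))) has_real_derivative \<delta> * (1 - t) ^ (CARD('d) - 1)) (at t)"
      by simp
  qed (use \<delta> in auto)
  also have "\<dots> = ennreal (\<delta> / real CARD('d))"
    by (simp add: power_0_left)
  finally show ?thesis .
qed

text \<open>
  The reciprocal form of \<open>1 + y \<le> exp y\<close> at \<open>y = 1 / (x - 1)\<close>: a lower bound for \<open>1 - 1/x\<close> that survives
  taking high powers.
\<close>

lemma exp_minus_inverse_le:
  assumes "1 < (x::real)"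
  shows "exp (- (1 / (x - 1))) \<le> 1 - 1 / x"
proof -
  have "x / (x - 1) = 1 + 1 / (x - 1)" using assms by (simp add: field_simps)
  also have "\<dots> \<le> exp (1 / (x - 1))" by simp
  finally have "inverse (exp (1 / (x - 1))) \<le> inverse (x / (x - 1))"
    using assms by (intro le_imp_inverse_le) auto
  then show ?thesis using assms by (simp add: exp_minus diff_divide_distrib)
qed

context uniform_sample
begin

text \<open>
  The width \<open>d/n\<close> of the slab makes the mean cut per sample point \<open>1/n\<close>, so that the product over
  the \<open>n\<close> points stays bounded away from zero.
\<close>

lemma expectation_disp_ge_dim:
  assumes "n \<ge> CARD('d)"
  shows "real CARD('d) / real n * (1 - 1 / real n) ^ n \<le> expectation (\<lambda>\<omega>. disp n (\<lambda>i. X i \<omega>))"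
proof -
  fix k0 :: 'd
  define \<delta> where "\<delta> = real CARD('d) / real n"
  have n: "0 < n" using assms by (meson order_less_le_trans zero_less_card_finite)
  have \<delta>: "0 \<le> \<delta>" "\<delta> \<le> 1" using assms n by (auto simp: \<delta>_def)
  interpret U: prob_space \<U> by (rule prob_space_unit_cube)
  have int: "integrable \<U> (cut k0 \<delta>)"
    by (rule U.integrable_const_bound[where B = 1]) (auto simp: cut_le)
  have "ennreal (\<integral>x. cut k0 \<delta> x \<partial>\<U>) = (\<integral>\<^sup>+x. ennreal (cut k0 \<delta> x) \<partial>\<U>)"
    by (rule nn_integral_eq_integral[symmetric, OF int]) (simp add: cut_le)
  also have "\<dots> \<le> ennreal (\<delta> / real CARD('d))" by (rule nn_integral_cut_le[OF \<delta>])
  finally have "(\<integral>x. cut k0 \<delta> x \<partial>\<U>) \<le> \<delta> / real CARD('d)" using \<delta> by simp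
  also have "\<dots> = 1 / real n" by (simp add: \<delta>_def)
  finally have "1 - 1 / real n \<le> (\<integral>x. 1 - cut k0 \<delta> x \<partial>\<U>)"
    using int U.prob_space by simp
  then have "\<delta> * (1 - 1 / real n) ^ n \<le> \<delta> * (\<integral>x. 1 - cut k0 \<delta> x \<partial>\<U>) ^ n"
    using \<delta> n by (intro mult_left_mono power_mono) auto
  also have "\<dots> = expectation (\<lambda>\<omega>. \<delta> * (\<Prod>i\<in>{1..n}. 1 - cut k0 \<delta> (X i \<omega>)))"
    by (subst expectation_prod(1)[where C = 1, symmetric]) (auto simp: cut_le)
  also have "\<dots> \<le> expectation (\<lambda>\<omega>. disp n (\<lambda>i. X i \<omega>))"
  proof (rule integral_mono[OF _ integrable_disp])
    show "integrable M (\<lambda>\<omega>. \<delta> * (\<Prod>i\<in>{1..n}. 1 - cut k0 \<delta> (X i \<omega>)))"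
      by (intro integrable_mult_right expectation_prod(2)[where C = 1]) (auto simp: cut_le)
  qed (rule disp_ge_cut[OF \<delta>])
  finally show ?thesis by (simp add: \<delta>_def)
qed

section \<open>Lower bound by counting empty slabs\<close>

text \<open>
  Let \<open>N\<close> be the number of slabs without sample points; its mean is \<open>\<mu>\<close>. Two slabs are both empty with probability
  \<open>(1 - 2/m)^n \<le> (1 - 1/m)^(2 n)\<close>, so the second moment of \<open>N\<close> is at most \<open>\<mu> + \<mu>\<^sup>2\<close>. In place of the
  Cauchy--Schwarz inequality, the pointwise bound \<open>2 c N - c\<^sup>2 N\<^sup>2 \<le> 1\<close>, whose left-hand side is zero for \<open>N = 0\<close>,
  estimates the probability of \<open>N > 0\<close>; the optimal \<open>c\<close> is \<open>1 / (1 + \<mu>)\<close>.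
\<close>

lemma expectation_disp_ge_slabs:
  assumes m: "m \<ge> 2"
  defines "\<mu> \<equiv> real m * (1 - 1 / real m) ^ n"
  shows "\<mu> / (1 + \<mu>) / real m \<le> expectation (\<lambda>\<omega>. disp n (\<lambda>i. X i \<omega>))"
proof -
  fix k0 :: 'd
  define a where "a j = ((\<chi> k. if k = k0 then real j / real m else 0) :: real ^ 'd)" for j
  define b where "b j = ((\<chi> k. if k = k0 then real (Suc j) / real m else 1) :: real ^ 'd)" for j
  define Z where "Z j \<omega> = (\<Prod>i\<in>{1..n}. indicator (- box (a j) (b j)) (X i \<omega>) :: real)" for j \<omega>
  define q where "q = (1 - 1 / real m) ^ n"
  have corners: "cube_corners (a j) (b j)" if "j < m" for j
    using that m by (auto simp: cube_corners_def a_def b_def divide_simps)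
  have vol: "(\<Prod>k\<in>UNIV. b j $ k - a j $ k) = 1 / real m" for j
  proof -
    have "(\<Prod>k\<in>UNIV. b j $ k - a j $ k) = (\<Prod>k\<in>UNIV. if k = k0 then 1 / real m else 1)"
      using m by (intro prod.cong) (auto simp: a_def b_def field_simps)
    then show ?thesis by simp
  qed
  interpret U: prob_space \<U> by (rule prob_space_unit_cube)
  have meas: "measure \<U> (box (a j) (b j)) = 1 / real m" if "j < m" for j
    using measure_unit_cube_box(2)[OF corners[OF that]] vol by simp
  have disj: "box (a j) (b j) \<inter> box (a l) (b l) = {}" if "j < l" for j l
  proof -
    have "real (Suc j) / real m \<le> real l / real m"
      using that by (intro divide_right_mono) auto
    then have "b j $ k0 \<le> a l $ k0" by (simp add: a_def b_def)
    then show ?thesis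
      by (auto simp: mem_box_cart) (meson less_trans not_less)
  qed
  have meas2: "measure \<U> (box (a j) (b j) \<union> box (a l) (b l)) = 2 / real m" if "j < m" "l < m" "j \<noteq> l" for j l
  proof -
    have "box (a j) (b j) \<inter> box (a l) (b l) = {}"
      using disj[of j l] disj[of l j] that(3) by (cases "j < l") auto
    then show ?thesis
      using meas[OF that(1)] meas[OF that(2)] by (subst U.finite_measure_Union) auto
  qed
  have Zint: "integrable M (Z j)" for j
    unfolding Z_def by (rule expectation_avoid(2)) simp
  have ZZ: "Z j \<omega> * Z l \<omega> = (\<Prod>i\<in>{1..n}. indicator (- (box (a j) (b j) \<union> box (a l) (b l))) (X i \<omega>))" for j l \<omega>
    unfolding Z_def prod.distrib[symmetric] by (intro prod.cong) (auto simp: indicator_def)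
  have ZZint: "integrable M (\<lambda>\<omega>. Z j \<omega> * Z l \<omega>)" for j l
    unfolding ZZ by (rule expectation_avoid(2)) simp
  have EZ: "expectation (Z j) = q" if "j < m" for j
    unfolding Z_def q_def using meas[OF that] by (subst expectation_avoid(1)) simp_all
  have q0: "0 \<le> q" using m by (simp add: q_def)
  have EZZ: "expectation (\<lambda>\<omega>. Z j \<omega> * Z l \<omega>) \<le> (if j = l then q else 0) + q * q" if "j < m" "l < m" for j l
  proof (cases "j = l")
    case True
    have "expectation (\<lambda>\<omega>. Z j \<omega> * Z l \<omega>) = q"
      unfolding ZZ q_def using meas[OF that(1)] True by (subst expectation_avoid(1)) simp_all
    then show ?thesis using True q0 by simp
  next
    case False
    have "expectation (\<lambda>\<omega>. Z j \<omega> * Z l \<omega>) = (1 - 2 / real m) ^ n"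
      unfolding ZZ using meas2[OF that False] by (subst expectation_avoid(1)) simp_all
    also have "\<dots> \<le> ((1 - 1 / real m) * (1 - 1 / real m)) ^ n"
      using m by (intro power_mono) (auto simp: field_simps)
    also have "\<dots> = q * q" by (simp add: q_def power_mult_distrib)
    finally show ?thesis using False by simp
  qed
  define N where "N \<omega> = (\<Sum>j<m. Z j \<omega>)" for \<omega>
  have mu: "\<mu> = real m * q" "0 \<le> \<mu>" using q0 by (auto simp: \<mu>_def q_def)
  have NN: "N \<omega> * N \<omega> = (\<Sum>j<m. \<Sum>l<m. Z j \<omega> * Z l \<omega>)" for \<omega>
    unfolding N_def by (rule sum_product)
  have EN: "expectation N = \<mu>"
    unfolding N_def using Zint by (subst Bochner_Integration.integral_sum) (auto simp: EZ mu)
  have ENN: "expectation (\<lambda>\<omega>. N \<omega> * N \<omega>) \<le> \<mu> + \<mu> * \<mu>"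
  proof -
    have "expectation (\<lambda>\<omega>. N \<omega> * N \<omega>) = (\<Sum>j<m. \<Sum>l<m. expectation (\<lambda>\<omega>. Z j \<omega> * Z l \<omega>))"
      unfolding NN using ZZint by (subst Bochner_Integration.integral_sum | intro sum.cong refl Bochner_Integration.integrable_sum)+ auto
    also have "\<dots> \<le> (\<Sum>j<m. \<Sum>l<m. (if j = l then q else 0) + q * q)"
      by (intro sum_mono EZZ) auto
    also have "\<dots> = \<mu> + \<mu> * \<mu>" by (simp add: sum.distrib mu algebra_simps)
    finally show ?thesis .
  qed
  define c where "c = 1 / (1 + \<mu>)"
  have Nint: "integrable M N" "integrable M (\<lambda>\<omega>. N \<omega> * N \<omega>)"
    unfolding NN unfolding N_def using Zint ZZint by (auto intro!: Bochner_Integration.integrable_sum)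
  have "\<mu> / (1 + \<mu>) = 2 * c * \<mu> - c * c * (\<mu> + \<mu> * \<mu>)"
    using mu(2) by (simp add: c_def divide_simps) (simp add: algebra_simps)
  also have "\<dots> \<le> 2 * c * expectation N - c * c * expectation (\<lambda>\<omega>. N \<omega> * N \<omega>)"
    unfolding EN by (intro diff_mono order_refl mult_left_mono ENN) simp
  finally have "\<mu> / (1 + \<mu>) / real m \<le> (2 * c * expectation N - c * c * expectation (\<lambda>\<omega>. N \<omega> * N \<omega>)) / real m"
    by (intro divide_right_mono) auto
  also have "\<dots> = expectation (\<lambda>\<omega>. (2 * c * N \<omega> - c * c * (N \<omega> * N \<omega>)) / real m)"
    using Nint by simp
  also have "\<dots> \<le> expectation (\<lambda>\<omega>. disp n (\<lambda>i. X i \<omega>))"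
  proof (rule integral_mono[OF _ integrable_disp])
    show "integrable M (\<lambda>\<omega>. (2 * c * N \<omega> - c * c * (N \<omega> * N \<omega>)) / real m)"
      using Nint by (intro Bochner_Integration.integrable_diff integrable_divide integrable_mult_right)
    fix \<omega>
    show "(2 * c * N \<omega> - c * c * (N \<omega> * N \<omega>)) / real m \<le> disp n (\<lambda>i. X i \<omega>)"
    proof (cases "\<forall>j<m. Z j \<omega> = 0")
      case True
      then show ?thesis by (simp add: N_def disp_nonneg)
    next
      case False
      then obtain j where j: "j < m" "Z j \<omega> \<noteq> 0" by auto
      then have "\<forall>i\<in>{1..n}. X i \<omega> \<notin> box (a j) (b j)"
        by (auto simp: Z_def indicator_def)
      then have "1 / real m \<le> disp n (\<lambda>i. X i \<omega>)"
        using disp_ge_box[OF corners[OF j(1)], of "\<lambda>i. X i \<omega>" n] vol[of j] by force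
      moreover have "2 * c * N \<omega> - c * c * (N \<omega> * N \<omega>) \<le> 1"
        using zero_le_power2[of "1 - c * N \<omega>"] by (simp add: power2_eq_square algebra_simps)
      then have "(2 * c * N \<omega> - c * c * (N \<omega> * N \<omega>)) / real m \<le> 1 / real m"
        by (intro divide_right_mono) auto
      ultimately show ?thesis by linarith
    qed
  qed
  finally show ?thesis .
qed

section \<open>Choice of the parameters\<close>

text \<open>
  The number of slabs \<open>m\<close> is the largest one with \<open>1/(2 m) \<ge> ln n / (9 n)\<close>. Then \<open>(1 - 1/m)^n \<ge> 1 / sqrt n\<close> and
  \<open>m \<ge> sqrt n\<close>, so that the mean number of empty slabs is at least one.
\<close>

lemma expectation_disp_ge_log:
  assumes n: "n \<ge> 2"
  shows "ln (real n) / (9 * real n) \<le> expectation (\<lambda>\<omega>. disp n (\<lambda>i. X i \<omega>))"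
proof -
  define l where "l = ln (real n)"
  have l: "0 < l" using n by (simp add: l_def)
  have l_n: "l \<le> real n" using n ln_le_minus_one[of "real n"] by (simp add: l_def)
  have l_sqrt: "l \<le> 2 * sqrt (real n)"
    using n ln_le_minus_one[of "sqrt (real n)"] by (simp add: l_def ln_sqrt)
  define m where "m = nat \<lfloor>9 * real n / (2 * l)\<rfloor>"
  have m_le: "real m \<le> 9 * real n / (2 * l)"
    using l by (simp add: m_def)
  have "9 * real n / (2 * l) < real m + 1"
    using l unfolding m_def by linarith
  moreover have "1 \<le> real n / l" using l l_n by simp
  moreover have "9 * real n / (2 * l) = 9 / 2 * (real n / l)" by simp
  ultimately have m_ge: "2 * (real n / l) \<le> real m - 1" by linarith
  then have m1: "1 < real m" using \<open>1 \<le> real n / l\<close> by linarith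
  then have m2: "m \<ge> 2" by linarith
  have sqrt_m: "sqrt (real n) \<le> real m"
  proof -
    have "sqrt (real n) * l \<le> 2 * (sqrt (real n) * sqrt (real n))"
      using mult_left_mono[OF l_sqrt, of "sqrt (real n)"] by (simp only: mult_ac real_sqrt_ge_zero of_nat_0_le_iff)
    then have "sqrt (real n) * l \<le> 2 * real n"
      by (simp only: real_sqrt_mult_self abs_of_nat)
    then have "sqrt (real n) \<le> 2 * (real n / l)" using l by (simp add: pos_le_divide_eq)
    then show ?thesis using m_ge by linarith
  qed
  have "exp (- (l / 2)) \<le> exp (real n * (- (1 / (real m - 1))))"
  proof -
    have "real n \<le> (real m - 1) * (l / 2)"
      using m_ge l by (simp add: field_simps)
    then show ?thesis using m1 by (simp add: divide_le_eq mult.commute)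
  qed
  also have "\<dots> = exp (- (1 / (real m - 1))) ^ n" by (rule exp_of_nat_mult)
  also have "\<dots> \<le> (1 - 1 / real m) ^ n"
    using exp_minus_inverse_le[OF m1] by (intro power_mono) auto
  finally have q: "exp (- (l / 2)) \<le> (1 - 1 / real m) ^ n" .
  define \<mu> where "\<mu> = real m * (1 - 1 / real m) ^ n"
  have "exp (l / 2) = sqrt (real n)"
    using n by (simp add: l_def exp_ln flip: ln_sqrt)
  then have "1 = sqrt (real n) * exp (- (l / 2))"
    using n by (simp add: exp_minus)
  also have "\<dots> \<le> \<mu>" unfolding \<mu>_def using sqrt_m q by (intro mult_mono) auto
  finally have mu: "1 \<le> \<mu>" .
  then have "1 / 2 \<le> \<mu> / (1 + \<mu>)" by (simp add: field_simps)
  then have "1 / 2 / real m \<le> \<mu> / (1 + \<mu>) / real m" by (rule divide_right_mono) simp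
  also have "\<dots> \<le> expectation (\<lambda>\<omega>. disp n (\<lambda>i. X i \<omega>))"
    unfolding \<mu>_def by (rule expectation_disp_ge_slabs[OF m2])
  also have "l / (9 * real n) \<le> 1 / 2 / real m"
    using m_le l n m1 by (simp add: field_simps)
  finally (xtrans) show ?thesis by (simp add: l_def)
qed

lemma expectation_disp_ge_linear:
  assumes "n > CARD('d)"
  shows "real CARD('d) / (2 * exp 1 * real n) \<le> expectation (\<lambda>\<omega>. disp n (\<lambda>i. X i \<omega>))"
proof -
  have "0 < CARD('d)" by simp
  then have n: "n \<ge> 2" using assms by linarith
  have "exp (- 1) = exp (real (n - 1) * (- (1 / (real n - 1))))"
    using n by (simp add: of_nat_diff)
  also have "\<dots> = exp (- (1 / (real n - 1))) ^ (n - 1)" by (rule exp_of_nat_mult)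
  also have "\<dots> \<le> (1 - 1 / real n) ^ (n - 1)"
    using n by (intro power_mono exp_minus_inverse_le) auto
  finally have "exp (- 1) * (1 / 2) \<le> (1 - 1 / real n) ^ (n - 1) * (1 - 1 / real n)"
    using n by (intro mult_mono) (auto simp: field_simps)
  also have "\<dots> = (1 - 1 / real n) ^ n" using n by (cases n) auto
  finally have "real CARD('d) / real n * (exp (- 1) * (1 / 2)) \<le> real CARD('d) / real n * (1 - 1 / real n) ^ n"
    by (intro mult_left_mono) auto
  also have "\<dots> \<le> expectation (\<lambda>\<omega>. disp n (\<lambda>i. X i \<omega>))"
    using assms by (intro expectation_disp_ge_dim) simp
  finally show ?thesis by (simp add: exp_minus field_simps)
qed

text \<open>
  In \<open>expectation_disp_power_le\<close> take \<open>q = d - 1\<close> and \<open>s = d t\<close>. Both sides are then bounded by \<open>d\<close>-th powers, and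
  taking roots removes the dimension: with \<open>r = n/d\<close> the expectation \<open>E\<close> satisfies
  \<open>E^(t + 2) \<le> (t / (e r))^t (t + 1)\<^sup>2\<close>. The choice \<open>t \<ge> 2 ln r\<close> gives \<open>e^t \<ge> r\<^sup>2\<close>, and then the right-hand
  side is at most \<open>((t + 1) / r)^(t + 2)\<close>.
\<close>

lemma expectation_disp_upper:
  assumes "n > CARD('d)"
  shows "expectation (\<lambda>\<omega>. disp n (\<lambda>i. X i \<omega>)) \<le> 4 * real CARD('d) / real n * ln (exp 1 * real n / real CARD('d))"
proof -
  define d where "d = CARD('d)"
  have d: "0 < d" by (simp add: d_def)
  have dn: "d < n" using assms by (simp add: d_def)
  define r where "r = real n / real d"
  have r: "1 < r" using d dn by (simp add: r_def)
  define L where "L = ln (exp 1 * real n / real d)"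
  have L: "L = 1 + ln r"
  proof -
    have "L = ln (exp 1 * r)" by (simp add: L_def r_def)
    then show ?thesis using r by (simp add: ln_mult)
  qed
  have L1: "1 \<le> L" using r by (simp add: L)
  define t where "t = nat \<lceil>2 * L\<rceil>"
  have t: "2 * L \<le> real t" "real t \<le> 2 * L + 1" using L1 unfolding t_def by linarith+
  define E where "E = expectation (\<lambda>\<omega>. disp n (\<lambda>i. X i \<omega>))"
  have E0: "0 \<le> E" unfolding E_def by (simp add: disp_nonneg)
  have E1: "E \<le> 1" unfolding E_def
    using integral_mono[OF integrable_disp integrable_const[of 1]] by (simp add: disp_le_1 prob_space)
  have "(E ^ (t + 2)) ^ d = E ^ (d * (t + 2))" by (simp only: power_mult[symmetric] mult.commute)
  \<comment> \<open>As \<open>E \<le> 1\<close>, the exponent may be rounded up from \<open>d t + d + 1\<close> to a multiple of \<open>d\<close>.\<close>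
  also have "\<dots> \<le> E ^ (d - 1 + d * t + 2)"
    using d E0 E1 by (intro power_decreasing) auto
  also have "\<dots> \<le> expectation (\<lambda>\<omega>. disp n (\<lambda>i. X i \<omega>) ^ (d - 1 + d * t + 2))"
    unfolding E_def by (intro expectation_power_le integrable_disp integrable_disp_power disp_nonneg)
  also have "\<dots> \<le> (real (d * t) / (exp 1 * real n)) ^ (d * t) *
      ((real (d - 1 + d * t) + 1) * (real (d - 1 + d * t) + 2) / ((real (d - 1) + 1) * (real (d - 1) + 2))) ^ CARD('d)"
    using dn by (intro expectation_disp_power_le) simp
  also have "\<dots> \<le> (real t / (exp 1 * r)) ^ (d * t) * ((real t + 1) * (real t + 1)) ^ d"
  proof (intro mult_mono)
    have "real (d * t) / (exp 1 * real n) = real t / (exp 1 * r)"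
      using d by (simp add: r_def)
    then show "(real (d * t) / (exp 1 * real n)) ^ (d * t) \<le> (real t / (exp 1 * r)) ^ (d * t)" by simp
    have eqs: "real (d - 1 + d * t) + 1 = real d + real d * real t" "real (d - 1 + d * t) + 2 = real d + real d * real t + 1"
      "real (d - 1) + 1 = real d" "real (d - 1) + 2 = real d + 1"
      using d by (simp_all add: of_nat_diff)
    have "real d \<ge> 1" using d by simp
    then have "(real d + real d * real t) * (real d + real d * real t + 1) / (real d * (real d + 1)) \<le> (real t + 1) * (real t + 1)"
      by (simp add: divide_le_eq) (simp add: algebra_simps)
    then have "(real (d - 1 + d * t) + 1) * (real (d - 1 + d * t) + 2) / ((real (d - 1) + 1) * (real (d - 1) + 2)) \<le> (real t + 1) * (real t + 1)"
      by (simp only: eqs)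
    then show "((real (d - 1 + d * t) + 1) * (real (d - 1 + d * t) + 2) / ((real (d - 1) + 1) * (real (d - 1) + 2))) ^ CARD('d) \<le> ((real t + 1) * (real t + 1)) ^ d"
      unfolding d_def[symmetric] by (intro power_mono) (auto intro!: divide_nonneg_nonneg mult_nonneg_nonneg)
  qed (use r in auto)
  also have "\<dots> = ((real t / (exp 1 * r)) ^ t * ((real t + 1) * (real t + 1))) ^ d"
    by (simp add: power_mult_distrib mult.commute[of d] power_mult)
  finally have "E ^ (t + 2) \<le> (real t / (exp 1 * r)) ^ t * ((real t + 1) * (real t + 1))"
    by (rule power_le_imp_le_base[of _ "d - 1", unfolded Suc_diff_1[OF d]]) (use r in auto)
  also have "(real t / (exp 1 * r)) ^ t \<le> ((real t + 1) / r) ^ t / (r * r)"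
  proof -
    have "r * r = exp (2 * ln r)" using r by (simp add: exp_double power2_eq_square)
    also have "\<dots> \<le> exp (real t * 1)" using t L by simp
    also have "\<dots> = exp 1 ^ t" by (rule exp_of_nat_mult)
    finally have rr: "r * r \<le> exp 1 ^ t" .
    have "(real t / (exp 1 * r)) ^ t = (real t / r) ^ t / exp 1 ^ t"
      by (simp add: power_divide power_mult_distrib)
    also have "\<dots> \<le> ((real t + 1) / r) ^ t / (r * r)"
      using r rr by (intro frac_le power_mono divide_right_mono) auto
    finally show ?thesis .
  qed
  finally have "E ^ (t + 2) \<le> ((real t + 1) / r) ^ t / (r * r) * ((real t + 1) * (real t + 1))"
    by (simp add: mult_right_mono)
  also have "\<dots> = ((real t + 1) / r) ^ (t + 2)"
    by (simp add: power_add power2_eq_square)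
  finally have "E \<le> (real t + 1) / r"
    using r by (intro power_le_imp_le_base[of E "t + 1"]) auto
  also have "\<dots> \<le> 4 * L / r" using t L1 r by (intro divide_right_mono) auto
  also have "\<dots> = 4 * real d / real n * L" by (simp add: r_def)
  finally show ?thesis by (simp add: E_def L_def d_def)
qed

end

theorem theorem1p1:
  fixes M :: "'a measure"
    and X :: "nat \<Rightarrow> 'a \<Rightarrow> real ^ 'd"
    and n :: nat
  assumes "prob_space M"
    and "n > CARD('d)"
    and "prob_space.indep_vars M (\<lambda>_. borel) X {1..n}"
    and "\<And>i. i \<in> {1..n} \<Longrightarrow> distr M borel (X i) = uniform_measure lborel unit_cube"
  shows "max (ln (real n) / (9 * real n)) (real CARD('d) / (2 * exp 1 * real n))
           \<le> prob_space.expectation M (\<lambda>\<omega>. disp n (\<lambda>i. X i \<omega>))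
       \<and> prob_space.expectation M (\<lambda>\<omega>. disp n (\<lambda>i. X i \<omega>))
           \<le> 9 * real CARD('d) / real n * ln (exp 1 * real n / real CARD('d))"
proof -
  interpret uniform_sample M X n
    by (intro uniform_sample.intro uniform_sample_axioms.intro assms)
  have "0 < CARD('d)" by simp
  then have n: "n \<ge> 2" using assms(2) by linarith
  have "1 \<le> exp 1 * (real n / real CARD('d))"
    using assms(2) by (intro mult_ge1_I) (auto simp: divide_simps)
  then have "0 \<le> ln (exp 1 * real n / real CARD('d))" by simp
  then have "4 * real CARD('d) / real n * ln (exp 1 * real n / real CARD('d))
      \<le> 9 * real CARD('d) / real n * ln (exp 1 * real n / real CARD('d))"
    by (intro mult_right_mono divide_right_mono) auto
  then show ?thesis
    using expectation_disp_ge_log[OF n] expectation_disp_ge_linear[OF assms(2)] expectation_disp_upper[OF assms(2)]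
    by (intro conjI max.boundedI) (assumption | rule order_trans)+
qed

end
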